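(* Let $\tilde{\mathfrak g}$ be a Lie algebra of dimension $5$ with a $\mathfrak z$-standard Sasaki structure. Then, up to isometry and $\mathcal D$-homothety, $\tilde{\mathfrak g}$ is one of \begin{gather*} (0,0,0,-2e^{12}-2\tau e^{35},0),\\ (0,0,2e^{35},-2e^{12}-2\tau e^{35},0),\\ (e^{15},e^{25},2\tau e^{12}+2e^{35},-2e^{12}-2\tau e^{35},0), \end{gather*} with $\tau=\pm1$, and the Sasaki structure is given by $$\tilde g=\pm(e^1\otimes e^1+e^2\otimes e^2)+\tau e^3\otimes e^3+e^4\otimes e^4+\tau e^5\otimes e^5,\qquad\xi=e_4,\qquad\Phi=-e^{12}-\tau e^{35}.$$
   Context: All structures are left-invariant and are described on a real finite-dimensional Lie algebra; metrics are nondegenerate symmetric bilinear forms of arbitrary signature. Notation: a tuple $(\beta_1,\dots,\beta_n)$ of $2$-forms denotes the Lie algebra with basis $e_1,\dots,e_n$ whose dual basis satisfies $de^i=\beta_i$, where $d\alpha(x,y)=-\alpha([x,y])$; $e^{ij}=e^i\wedge e^j=e^i\otimes e^j-e^j\otimes e^i$. An almost contact metric structure on a Lie algebra of dimension $2n+1$ is $(\phi,\xi,\eta,\tilde g)$ with $\phi$ an endomorphism, $\xi$ a vector, $\eta$ a $1$-form and $\tilde g$ a metric such that $\eta(\xi)=1$, $\eta\circ\phi=0$, $\phi^2=-\mathrm{Id}+\eta\otimes\xi$, $\tilde g(\xi,\xi)=1$, $\eta=\tilde g(\xi,\cdot)$, $\tilde g(\phi x,\phi y)=\tilde g(x,y)-\eta(x)\eta(y)$.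 Its fundamental form is $\Phi=\tilde g(\cdot,\phi\,\cdot)$. It is Sasaki if $d\eta=2\Phi$ and $N_\phi+d\eta\otimes\xi=0$, where $N_\phi(x,y)=\phi^2[x,y]+[\phi x,\phi y]-\phi[\phi x,y]-\phi[x,\phi y]$. A Sasaki structure on $\tilde{\mathfrak g}$ is $\mathfrak z$-standard if there is an orthogonal decomposition $\tilde{\mathfrak g}=\mathfrak g\rtimes\mathrm{Span}\{e_0\}$ with $\mathfrak g$ a nilpotent ideal, $\tilde g=g+\tau e^0\otimes e^0$ with $g$ a metric on $\mathfrak g$ and $\tau=\pm1$ ($e^0$ dual to $e_0$ and vanishing on $\mathfrak g$), and $b=-\phi(e_0)$ in the center of $\mathfrak g$. Two metric Lie algebras are isometric if the corresponding connected, simply connected Lie groups with left-invariant metrics are isometric as pseudo-Riemannian manifolds. A $\mathcal D$-homothety replaces a Sasaki structure $(\phi,\xi,\eta,g)$ by $(\phi,a^{-1}\xi,a\eta,ag+(a^2-a)\eta\otimes\eta)$ for a constant $a>0$. The theorem says that after a $\mathcal D$-homothety and passing to an isometric metric Lie algebra, $\tilde{\mathfrak g}$ with its Sasaki structure is one of those listed, for some choice of $\tau$ and of the sign $\pm$. *)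

theory Defs
  imports "HOL-Analysis.Analysis" "HOL-Algebra.Group"
begin

section \<open>Lie algebras and metrics\<close>

definition lie_algebra :: "('a::real_vector \<Rightarrow> 'a \<Rightarrow> 'a) \<Rightarrow> bool" where
  "lie_algebra br \<longleftrightarrow> bilinear br \<and> (\<forall>x. br x x = 0) \<and>
     (\<forall>x y z. br x (br y z) + br y (br z x) + br z (br x y) = 0)"

definition lie_ideal :: "('a::real_vector \<Rightarrow> 'a \<Rightarrow> 'a) \<Rightarrow> 'a set \<Rightarrow> bool" where
  "lie_ideal br I \<longleftrightarrow> subspace I \<and> (\<forall>x. \<forall>y\<in>I. br x y \<in> I)"

primrec lower_central :: "('a::real_vector \<Rightarrow> 'a \<Rightarrow> 'a) \<Rightarrow> 'a set \<Rightarrow> nat \<Rightarrow> 'a set" where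
  "lower_central br S 0 = S"
| "lower_central br S (Suc n) = span {br x y | x y. x \<in> S \<and> y \<in> lower_central br S n}"

definition nilpotent_lie :: "('a::real_vector \<Rightarrow> 'a \<Rightarrow> 'a) \<Rightarrow> 'a set \<Rightarrow> bool" where
  "nilpotent_lie br S \<longleftrightarrow> (\<exists>n. lower_central br S n \<subseteq> {0})"

definition lie_center :: "('a::real_vector \<Rightarrow> 'a \<Rightarrow> 'a) \<Rightarrow> 'a set \<Rightarrow> 'a set" where
  "lie_center br S = {x \<in> S. \<forall>y\<in>S. br x y = 0}"

text \<open>Metrics have arbitrary signature, so only nondegeneracy is required.\<close>

definition nondegenerate_on :: "'a::real_vector set \<Rightarrow> ('a \<Rightarrow> 'a \<Rightarrow> real) \<Rightarrow> bool" where
  "nondegenerate_on V g \<longleftrightarrow> (\<forall>x\<in>V. (\<forall>y\<in>V. g x y = 0) \<longrightarrow> x = 0)"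

definition metric_form :: "('a::real_vector \<Rightarrow> 'a \<Rightarrow> real) \<Rightarrow> bool" where
  "metric_form g \<longleftrightarrow> bilinear g \<and> (\<forall>x y. g x y = g y x) \<and> nondegenerate_on UNIV g"

section \<open>Sasaki structures\<close>

record 'a contact_metric =
  cm_phi :: "'a \<Rightarrow> 'a"
  cm_xi :: "'a"
  cm_eta :: "'a \<Rightarrow> real"
  cm_met :: "'a \<Rightarrow> 'a \<Rightarrow> real"

definition almost_contact_metric :: "'a::real_vector contact_metric \<Rightarrow> bool" where
  "almost_contact_metric S \<longleftrightarrow>
     linear (cm_phi S) \<and> linear (cm_eta S) \<and> metric_form (cm_met S) \<and>
     cm_eta S (cm_xi S) = 1 \<and>
     (\<forall>x. cm_eta S (cm_phi S x) = 0) \<and>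
     (\<forall>x. cm_phi S (cm_phi S x) = - x + cm_eta S x *\<^sub>R cm_xi S) \<and>
     cm_met S (cm_xi S) (cm_xi S) = 1 \<and>
     (\<forall>x. cm_eta S x = cm_met S (cm_xi S) x) \<and>
     (\<forall>x y. cm_met S (cm_phi S x) (cm_phi S y) = cm_met S x y - cm_eta S x * cm_eta S y)"

definition fundamental_form :: "'a contact_metric \<Rightarrow> 'a \<Rightarrow> 'a \<Rightarrow> real" where
  "fundamental_form S x y = cm_met S x (cm_phi S y)"

definition ext_deriv :: "('a \<Rightarrow> 'a \<Rightarrow> 'a) \<Rightarrow> ('a \<Rightarrow> real) \<Rightarrow> 'a \<Rightarrow> 'a \<Rightarrow> real" where
  "ext_deriv br \<alpha> x y = - \<alpha> (br x y)"

definition nijenhuis :: "('a::real_vector \<Rightarrow> 'a \<Rightarrow> 'a) \<Rightarrow> ('a \<Rightarrow> 'a) \<Rightarrow> 'a \<Rightarrow> 'a \<Rightarrow> 'a" where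
  "nijenhuis br \<phi> x y =
     \<phi> (\<phi> (br x y)) + br (\<phi> x) (\<phi> y) - \<phi> (br (\<phi> x) y) - \<phi> (br x (\<phi> y))"

definition sasaki :: "('a::real_vector \<Rightarrow> 'a \<Rightarrow> 'a) \<Rightarrow> 'a contact_metric \<Rightarrow> bool" where
  "sasaki br S \<longleftrightarrow> almost_contact_metric S \<and>
     (\<forall>x y. ext_deriv br (cm_eta S) x y = 2 * fundamental_form S x y) \<and>
     (\<forall>x y. nijenhuis br (cm_phi S) x y + ext_deriv br (cm_eta S) x y *\<^sub>R cm_xi S = 0)"

text \<open>The condition on the metric is \<open>g = g|\<^sub>I + \<tau> e\<^sup>0 \<otimes> e\<^sup>0\<close>, with \<open>e\<^sup>0\<close> dual to
  \<open>e\<^sub>0\<close> and vanishing on the ideal \<open>I\<close>.\<close>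

definition z_standard :: "('a::real_vector \<Rightarrow> 'a \<Rightarrow> 'a) \<Rightarrow> 'a contact_metric \<Rightarrow> bool" where
  "z_standard br S \<longleftrightarrow> (\<exists>I e0 \<tau>.
     lie_ideal br I \<and> nilpotent_lie br I \<and>
     e0 \<notin> I \<and> (\<forall>x. \<exists>y\<in>I. \<exists>t. x = y + t *\<^sub>R e0) \<and>
     nondegenerate_on I (cm_met S) \<and> \<tau> \<in> {1, -1} \<and>
     (\<forall>x\<in>I. \<forall>y\<in>I. \<forall>s t. cm_met S (x + s *\<^sub>R e0) (y + t *\<^sub>R e0) = cm_met S x y + \<tau> * s * t) \<and>
     - cm_phi S e0 \<in> lie_center br I)"

definition D_homothety :: "real \<Rightarrow> 'a::real_vector contact_metric \<Rightarrow> 'a contact_metric" where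
  "D_homothety a S =
     \<lparr> cm_phi = cm_phi S,
       cm_xi = inverse a *\<^sub>R cm_xi S,
       cm_eta = (\<lambda>x. a * cm_eta S x),
       cm_met = (\<lambda>x y. a * cm_met S x y + (a\<^sup>2 - a) * (cm_eta S x * cm_eta S y)) \<rparr>"

section \<open>Smooth manifolds\<close>

text \<open>On open subsets of Euclidean spaces, \<open>Ck_on k\<close> is being of class \<open>C\<^sup>k\<close>.\<close>

primrec Ck_on :: "nat \<Rightarrow> 'a::euclidean_space set \<Rightarrow> ('a \<Rightarrow> 'b::euclidean_space) \<Rightarrow> bool" where
  "Ck_on 0 S f \<longleftrightarrow> continuous_on S f"
| "Ck_on (Suc k) S f \<longleftrightarrow> (\<forall>x\<in>S. f differentiable (at x)) \<and>
     (\<forall>v. Ck_on k S (\<lambda>x. frechet_derivative f (at x) v))"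

definition smooth_on :: "'a::euclidean_space set \<Rightarrow> ('a \<Rightarrow> 'b::euclidean_space) \<Rightarrow> bool" where
  "smooth_on S f \<longleftrightarrow> (\<forall>k. Ck_on k S f)"

text \<open>A chart is a pair of its domain and its coordinate map.\<close>

type_synonym ('m, 'e) chart = "'m set \<times> ('m \<Rightarrow> 'e)"

abbreviation chart_inv :: "('m, 'e) chart \<Rightarrow> 'e \<Rightarrow> 'm" where
  "chart_inv k \<equiv> inv_into (fst k) (snd k)"

definition smooth_manifold :: "'m topology \<Rightarrow> ('m, 'e::euclidean_space) chart set \<Rightarrow> bool" where
  "smooth_manifold T A \<longleftrightarrow>
     Hausdorff_space T \<and> second_countable T \<and> (\<Union>k\<in>A. fst k) = topspace T \<and>
     (\<forall>k\<in>A. openin T (fst k) \<and> open (snd k ` fst k) \<and>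
        homeomorphic_map (subtopology T (fst k)) (top_of_set (snd k ` fst k)) (snd k)) \<and>
     (\<forall>k\<in>A. \<forall>l\<in>A. smooth_on (snd k ` (fst k \<inter> fst l)) (snd l \<circ> chart_inv k))"

definition smooth_map ::
  "'m topology \<Rightarrow> ('m, 'e::euclidean_space) chart set \<Rightarrow>
   'n topology \<Rightarrow> ('n, 'f::euclidean_space) chart set \<Rightarrow> ('m \<Rightarrow> 'n) \<Rightarrow> bool" where
  "smooth_map T A T' A' f \<longleftrightarrow> continuous_map T T' f \<and>
     (\<forall>k\<in>A. \<forall>l\<in>A'. smooth_on (snd k ` {p \<in> fst k. f p \<in> fst l}) (snd l \<circ> f \<circ> chart_inv k))"

definition prod_atlas ::
  "('m, 'e) chart set \<Rightarrow> ('n, 'f) chart set \<Rightarrow> ('m \<times> 'n, 'e \<times> 'f) chart set" where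
  "prod_atlas A B = (\<lambda>(k, l). (fst k \<times> fst l, map_prod (snd k) (snd l))) ` (A \<times> B)"

text \<open>The differential of \<open>f\<close> at \<open>p\<close>, as a linear map between the coordinate spaces of a chart
  \<open>k\<close> around \<open>p\<close> and a chart \<open>l\<close> around \<open>f p\<close>.\<close>

definition differential ::
  "('m, 'e::euclidean_space) chart \<Rightarrow> ('n, 'f::euclidean_space) chart \<Rightarrow> ('m \<Rightarrow> 'n) \<Rightarrow> 'm \<Rightarrow> 'e \<Rightarrow> 'f"
  where "differential k l f p = frechet_derivative (snd l \<circ> f \<circ> chart_inv k) (at (snd k p))"

text \<open>A vector field \<open>X\<close> is given by its components: \<open>X k p\<close> is the coordinate vector, in the chart
  \<open>k\<close> around \<open>p\<close>, of its value at \<open>p\<close>. Only values with \<open>k\<close> in the atlas and \<open>p\<close> in the domain of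
  \<open>k\<close> are meaningful.\<close>

type_synonym ('m, 'e) field = "('m, 'e) chart \<Rightarrow> 'm \<Rightarrow> 'e"

definition vector_field :: "('m, 'e::euclidean_space) chart set \<Rightarrow> ('m, 'e) field \<Rightarrow> bool" where
  "vector_field A X \<longleftrightarrow>
     (\<forall>k\<in>A. smooth_on (snd k ` fst k) (X k \<circ> chart_inv k)) \<and>
     (\<forall>k\<in>A. \<forall>l\<in>A. \<forall>p \<in> fst k \<inter> fst l. X l p = differential k l id p (X k p))"

definition field_bracket ::
  "('m, 'e::euclidean_space) field \<Rightarrow> ('m, 'e) field \<Rightarrow> ('m, 'e) field" where
  "field_bracket X Y k p =
     frechet_derivative (Y k \<circ> chart_inv k) (at (snd k p)) (X k p) -
     frechet_derivative (X k \<circ> chart_inv k) (at (snd k p)) (Y k p)"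

definition simply_connected_space :: "'m topology \<Rightarrow> bool" where
  "simply_connected_space T \<longleftrightarrow>
     (\<forall>p q. pathin T p \<and> p 1 = p 0 \<and> pathin T q \<and> q 1 = q 0 \<longrightarrow>
        homotopic_with (\<lambda>r. r 1 = r 0) (top_of_set {0..1}) T p q)"

section \<open>Lie groups\<close>

record ('m, 'e) lie_grp = "'m monoid" +
  gtop :: "'m topology"
  atlas :: "('m, 'e) chart set"

definition lie_group :: "('m, 'e::euclidean_space) lie_grp \<Rightarrow> bool" where
  "lie_group G \<longleftrightarrow> group G \<and> topspace (gtop G) = carrier G \<and> smooth_manifold (gtop G) (atlas G) \<and>
     smooth_map (prod_topology (gtop G) (gtop G)) (prod_atlas (atlas G) (atlas G))
       (gtop G) (atlas G) (\<lambda>(p, q). mult G p q) \<and>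
     smooth_map (gtop G) (atlas G) (gtop G) (atlas G) (m_inv G)"

definition left_invariant_field :: "('m, 'e::euclidean_space) lie_grp \<Rightarrow> ('m, 'e) field \<Rightarrow> bool" where
  "left_invariant_field G X \<longleftrightarrow> vector_field (atlas G) X \<and>
     (\<forall>h\<in>carrier G. \<forall>k\<in>atlas G. \<forall>l\<in>atlas G. \<forall>p\<in>fst k. mult G h p \<in> fst l \<longrightarrow>
        X l (mult G h p) = differential k l (mult G h) p (X k p))"

text \<open>\<open>L\<close> identifies the Lie algebra with bracket \<open>br\<close> with the Lie algebra of left-invariant vector
  fields on \<open>G\<close>.\<close>

definition lie_algebra_of ::
  "('m, 'e::euclidean_space) lie_grp \<Rightarrow> ('a::real_vector \<Rightarrow> ('m, 'e) field) \<Rightarrow> ('a \<Rightarrow> 'a \<Rightarrow> 'a) \<Rightarrow> bool"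
  where
  "lie_algebra_of G L br \<longleftrightarrow>
     (\<forall>x. left_invariant_field G (L x)) \<and>
     (\<forall>k\<in>atlas G. \<forall>p\<in>fst k. linear (\<lambda>x. L x k p)) \<and>
     (\<forall>X. left_invariant_field G X \<longrightarrow> (\<exists>!x. \<forall>k\<in>atlas G. \<forall>p\<in>fst k. X k p = L x k p)) \<and>
     (\<forall>x y. \<forall>k\<in>atlas G. \<forall>p\<in>fst k. L (br x y) k p = field_bracket (L x) (L y) k p)"

definition corresponding_group ::
  "('m, 'e::euclidean_space) lie_grp \<Rightarrow> ('a::real_vector \<Rightarrow> ('m, 'e) field) \<Rightarrow> ('a \<Rightarrow> 'a \<Rightarrow> 'a) \<Rightarrow> bool"
  where
  "corresponding_group G L br \<longleftrightarrow> lie_group G \<and> connected_space (gtop G) \<and>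
     simply_connected_space (gtop G) \<and> lie_algebra_of G L br"

text \<open>The Maurer--Cartan form: the element of the Lie algebra whose left-invariant field takes the
  value \<open>u\<close> at \<open>p\<close>. Composing with it turns tensors on the Lie algebra into left-invariant tensors
  on the group.\<close>

definition maurer_cartan ::
  "('a \<Rightarrow> ('m, 'e) field) \<Rightarrow> ('m, 'e) chart \<Rightarrow> 'm \<Rightarrow> 'e \<Rightarrow> 'a" where
  "maurer_cartan L k p u = inv_into UNIV (\<lambda>x. L x k p) u"

definition left_invariant_metric ::
  "('a \<Rightarrow> ('m, 'e) field) \<Rightarrow> ('a \<Rightarrow> 'a \<Rightarrow> real) \<Rightarrow> ('m, 'e) chart \<Rightarrow> 'm \<Rightarrow> 'e \<Rightarrow> 'e \<Rightarrow> real" where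
  "left_invariant_metric L g k p u v = g (maurer_cartan L k p u) (maurer_cartan L k p v)"

definition left_invariant_one_form ::
  "('a \<Rightarrow> ('m, 'e) field) \<Rightarrow> ('a \<Rightarrow> real) \<Rightarrow> ('m, 'e) chart \<Rightarrow> 'm \<Rightarrow> 'e \<Rightarrow> real" where
  "left_invariant_one_form L \<alpha> k p u = \<alpha> (maurer_cartan L k p u)"

definition left_invariant_endomorphism ::
  "('a \<Rightarrow> ('m, 'e) field) \<Rightarrow> ('a \<Rightarrow> 'a) \<Rightarrow> ('m, 'e) chart \<Rightarrow> 'm \<Rightarrow> 'e \<Rightarrow> 'e" where
  "left_invariant_endomorphism L \<phi> k p u = L (\<phi> (maurer_cartan L k p u)) k p"

definition diffeomorphism ::
  "('m, 'e::euclidean_space) lie_grp \<Rightarrow> ('n, 'f::euclidean_space) lie_grp \<Rightarrow> ('m \<Rightarrow> 'n) \<Rightarrow> bool" where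
  "diffeomorphism G H f \<longleftrightarrow> bij_betw f (carrier G) (carrier H) \<and>
     smooth_map (gtop G) (atlas G) (gtop H) (atlas H) f \<and>
     smooth_map (gtop H) (atlas H) (gtop G) (atlas G) (inv_into (carrier G) f)"

text \<open>Isometries need not be group homomorphisms.\<close>

definition lie_group_isometry ::
  "('m, 'e::euclidean_space) lie_grp \<Rightarrow> ('a \<Rightarrow> ('m, 'e) field) \<Rightarrow> ('a \<Rightarrow> 'a \<Rightarrow> real) \<Rightarrow>
   ('n, 'f::euclidean_space) lie_grp \<Rightarrow> ('b \<Rightarrow> ('n, 'f) field) \<Rightarrow> ('b \<Rightarrow> 'b \<Rightarrow> real) \<Rightarrow>
   ('m \<Rightarrow> 'n) \<Rightarrow> bool" where
  "lie_group_isometry G L g H M h f \<longleftrightarrow> diffeomorphism G H f \<and>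
     (\<forall>k\<in>atlas G. \<forall>l\<in>atlas H. \<forall>p\<in>fst k. f p \<in> fst l \<longrightarrow>
        (\<forall>u v. left_invariant_metric M h l (f p) (differential k l f p u) (differential k l f p v)
             = left_invariant_metric L g k p u v))"

text \<open>The map \<open>f\<close> carries the left-invariant tensors \<open>\<phi>, \<xi>, \<eta>\<close> of \<open>S\<close> to those of \<open>S'\<close>.\<close>

definition preserves_contact ::
  "('m, 'e::euclidean_space) lie_grp \<Rightarrow> ('a \<Rightarrow> ('m, 'e) field) \<Rightarrow> 'a contact_metric \<Rightarrow>
   ('n, 'f::euclidean_space) lie_grp \<Rightarrow> ('b \<Rightarrow> ('n, 'f) field) \<Rightarrow> 'b contact_metric \<Rightarrow>
   ('m \<Rightarrow> 'n) \<Rightarrow> bool" where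
  "preserves_contact G L S H M S' f \<longleftrightarrow>
     (\<forall>k\<in>atlas G. \<forall>l\<in>atlas H. \<forall>p\<in>fst k. f p \<in> fst l \<longrightarrow>
        differential k l f p (L (cm_xi S) k p) = M (cm_xi S') l (f p) \<and>
        (\<forall>u. left_invariant_one_form M (cm_eta S') l (f p) (differential k l f p u)
           = left_invariant_one_form L (cm_eta S) k p u) \<and>
        (\<forall>u. left_invariant_endomorphism M (cm_phi S') l (f p) (differential k l f p u)
           = differential k l f p (left_invariant_endomorphism L (cm_phi S) k p u)))"

text \<open>Isometry of metric Lie algebras, compatible with the Sasaki structures. The points of the
  groups are taken in the type \<open>'b\<close> only because a type must be fixed: topology and atlas are
  arbitrary, and a connected Lie group of positive dimension has the cardinality of the continuum,
  so it can be transported to a subset of \<open>'b\<close>. The connected simply connected group of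
  a Lie algebra is unique up to isomorphism, so its choice does not matter.\<close>

definition sasaki_isometric ::
  "('a::real_vector \<Rightarrow> 'a \<Rightarrow> 'a) \<Rightarrow> 'a contact_metric \<Rightarrow>
   ('b::euclidean_space \<Rightarrow> 'b \<Rightarrow> 'b) \<Rightarrow> 'b contact_metric \<Rightarrow> bool" where
  "sasaki_isometric br S br' S' \<longleftrightarrow>
     (\<exists>(G :: ('b, 'b) lie_grp) L (H :: ('b, 'b) lie_grp) M f.
        corresponding_group G L br \<and> corresponding_group H M br' \<and>
        lie_group_isometry G L (cm_met S) H M (cm_met S') f \<and>
        preserves_contact G L S H M S' f)"

section \<open>The five-dimensional models\<close>

text \<open>In \<open>real ^ 5\<close> the basis vector \<open>e\<^sub>i\<close> is \<open>axis i 1\<close> and \<open>e\<^sup>i\<close> is the component \<open>x $ i\<close>; the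
  index \<open>5 :: 5\<close> equals \<open>0\<close>, and is distinct from \<open>1, 2, 3, 4\<close>.\<close>

definition e2 :: "5 \<Rightarrow> 5 \<Rightarrow> real ^ 5 \<Rightarrow> real ^ 5 \<Rightarrow> real" where
  "e2 i j x y = x $ i * y $ j - x $ j * y $ i"

text \<open>The bracket for which \<open>de\<^sup>i = \<beta>\<^sub>i\<close>, where \<open>de\<^sup>i(x,y) = - e\<^sup>i([x,y])\<close>.\<close>

definition bracket5 ::
  "(real ^ 5 \<Rightarrow> real ^ 5 \<Rightarrow> real) \<Rightarrow> (real ^ 5 \<Rightarrow> real ^ 5 \<Rightarrow> real) \<Rightarrow> (real ^ 5 \<Rightarrow> real ^ 5 \<Rightarrow> real) \<Rightarrow>
   (real ^ 5 \<Rightarrow> real ^ 5 \<Rightarrow> real) \<Rightarrow> (real ^ 5 \<Rightarrow> real ^ 5 \<Rightarrow> real) \<Rightarrow> real ^ 5 \<Rightarrow> real ^ 5 \<Rightarrow> real ^ 5"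
  where
  "bracket5 \<beta>1 \<beta>2 \<beta>3 \<beta>4 \<beta>5 x y =
     (\<chi> i. - (if i = 1 then \<beta>1 x y else if i = 2 then \<beta>2 x y else if i = 3 then \<beta>3 x y
              else if i = 4 then \<beta>4 x y else \<beta>5 x y))"

definition model1 :: "real \<Rightarrow> real ^ 5 \<Rightarrow> real ^ 5 \<Rightarrow> real ^ 5" where
  "model1 \<tau> = bracket5 (\<lambda>x y. 0) (\<lambda>x y. 0) (\<lambda>x y. 0)
     (\<lambda>x y. - 2 * e2 1 2 x y - 2 * \<tau> * e2 3 5 x y) (\<lambda>x y. 0)"

definition model2 :: "real \<Rightarrow> real ^ 5 \<Rightarrow> real ^ 5 \<Rightarrow> real ^ 5" where
  "model2 \<tau> = bracket5 (\<lambda>x y. 0) (\<lambda>x y. 0) (\<lambda>x y. 2 * e2 3 5 x y)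
     (\<lambda>x y. - 2 * e2 1 2 x y - 2 * \<tau> * e2 3 5 x y) (\<lambda>x y. 0)"

definition model3 :: "real \<Rightarrow> real ^ 5 \<Rightarrow> real ^ 5 \<Rightarrow> real ^ 5" where
  "model3 \<tau> = bracket5 (e2 1 5) (e2 2 5) (\<lambda>x y. 2 * \<tau> * e2 1 2 x y + 2 * e2 3 5 x y)
     (\<lambda>x y. - 2 * e2 1 2 x y - 2 * \<tau> * e2 3 5 x y) (\<lambda>x y. 0)"

definition model_metric :: "real \<Rightarrow> real \<Rightarrow> real ^ 5 \<Rightarrow> real ^ 5 \<Rightarrow> real" where
  "model_metric \<epsilon> \<tau> x y =
     \<epsilon> * (x $ 1 * y $ 1 + x $ 2 * y $ 2) + \<tau> * (x $ 3 * y $ 3) + x $ 4 * y $ 4 + \<tau> * (x $ 5 * y $ 5)"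

end

theory Submission
  imports Defs
begin

text \<open>Write \<open>b = -\<phi>(e\<^sub>0)\<close>. Because \<open>b\<close> is central in the ideal \<open>I\<close>, the Sasaki condition
  \<open>d\<eta> = 2\<Phi>\<close> makes \<open>\<phi> b\<close> orthogonal to \<open>I\<close>; this gives \<open>\<eta>(e\<^sub>0) = 0\<close>, so that \<open>\<xi>\<close> lies in \<open>I\<close> and
  the whole space is the orthogonal sum of \<open>b, \<xi>, e\<^sub>0\<close> and a \<open>\<phi>\<close>-invariant plane \<open>W\<close>, on which the
  metric is definite because \<open>\<phi>\<close> acts as an isometric complex structure. Let \<open>w \<in> W\<close> have
  norm \<open>\<epsilon> = \<plusminus>1\<close>. Nilpotency of \<open>I\<close> forces \<open>\<xi>\<close> to be central and \<open>[w, \<phi> w]\<close> to lie in the span of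
  \<open>b\<close> and \<open>\<xi>\<close>, and the normality condition makes \<open>ad e\<^sub>0\<close> complex linear on \<open>W\<close>. All that is left
  are three numbers \<open>p, q, l\<close> with
  \<open>[w, \<phi> w] = -2p\<epsilon>\<tau> b + 2\<epsilon> \<xi>\<close>, \<open>[e\<^sub>0, w] = p w + q \<phi> w\<close>, \<open>[e\<^sub>0, b] = l b - 2\<tau> \<xi>\<close>,
  and the Jacobi identity for \<open>e\<^sub>0, w, \<phi> w\<close> says \<open>p (l - 2p) = 0\<close> (lemma \<open>frame_brackets\<close>).

  A \<open>\<D>\<close>-homothety, together with a change of sign of \<open>e\<^sub>0\<close>, multiplies \<open>(p, q, l)\<close> by an arbitrary
  nonzero number. As either \<open>p = 0\<close> or \<open>l = 2p\<close>, the pair \<open>(p, l)\<close> can be brought to \<open>(0,0)\<close>,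
  \<open>(0,2)\<close> or \<open>(1,2)\<close>; these are the three models, except for \<open>q\<close>.

  The number \<open>q\<close> is removed by an isometry that is not a homomorphism. The simply connected group
  is realised on the whole of \<open>\<real>\<^sup>5\<close>, in exponential coordinates of \<open>I\<close> followed by the parameter
  \<open>t\<close> of \<open>e\<^sub>0\<close>. There left translations are affine, \<open>y \<mapsto> x + A(x) y\<close>, so the left-invariant fields
  are \<open>x \<mapsto> A(x) v\<close> and everything about the group follows from the matrices \<open>A(x)\<close> (locale
  \<open>affine_group\<close>). The rotation part of \<open>ad e\<^sub>0\<close> enters \<open>A(x)\<close> only as a rotation by an angle
  proportional to \<open>t\<close>, applied first; this rotation preserves \<open>\<phi>, \<xi>, \<eta>\<close> and the metric at the unit.
  Hence the groups with and without \<open>q\<close> have the same left-invariant tensors on \<open>\<real>\<^sup>5\<close>, and the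
  identity map is the required isometry (lemma \<open>sasaki_isometric_solv\<close>).\<close>

section \<open>Smooth functions\<close>

text \<open>Smoothness is defined by recursion on the order, with the derivative evaluated at fixed vectors;
  each closure property is proved by the same recursion, the induction hypothesis being applied to
  the terms of the formula for the derivative.\<close>

lemma frechet_derivative_eq:
  "(f has_derivative f') (at x) \<Longrightarrow> frechet_derivative f (at x) v = f' v"
  using frechet_derivative_at[of f f' x] by simp

lemma Ck_on_SucD: "Ck_on (Suc k) S f \<Longrightarrow> Ck_on k S f"
proof (induction k arbitrary: f)
  case 0
  then show ?case
    by (auto intro: continuous_at_imp_continuous_on differentiable_imp_continuous_within)
qed auto

lemma Ck_on_const: "Ck_on k S (\<lambda>_. c)"
proof (induction k arbitrary: c)
  case (Suc k)
  then show ?case by (auto simp: frechet_derivative_const)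
qed auto

lemma Ck_on_add:
  "Ck_on k UNIV f \<Longrightarrow> Ck_on k UNIV g \<Longrightarrow> Ck_on k UNIV (\<lambda>x. f x + g x)"
proof (induction k arbitrary: f g)
  case 0
  then show ?case by (auto intro: continuous_on_add)
next
  case (Suc k)
  then have "frechet_derivative (\<lambda>x. f x + g x) (at x) v
      = frechet_derivative f (at x) v + frechet_derivative g (at x) v" for x v
    by (intro frechet_derivative_eq has_derivative_add) (auto simp: frechet_derivative_works)
  with Suc show ?case by auto
qed

lemma Ck_on_linear: "linear f \<Longrightarrow> Ck_on k UNIV f"
proof (cases k)
  case 0
  then show "linear f \<Longrightarrow> ?thesis" by (simp add: linear_continuous_on linear_linear)
next
  case (Suc n)
  assume l: "linear f"
  then have "(f has_derivative f) (at x)" for x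
    using linear_imp_has_derivative by blast
  then have "frechet_derivative f (at x) = f" "f differentiable (at x)" for x
    using frechet_derivative_at[of f f x] by (auto simp: differentiable_def)
  then show ?thesis by (simp add: Suc Ck_on_const)
qed

lemma Ck_on_scaleR:
  fixes f :: "'a::euclidean_space \<Rightarrow> real"
  shows "Ck_on k UNIV f \<Longrightarrow> Ck_on k UNIV g \<Longrightarrow> Ck_on k UNIV (\<lambda>x. f x *\<^sub>R g x)"
proof (induction k arbitrary: f g)
  case 0
  then show ?case by (auto intro: continuous_on_scaleR)
next
  case (Suc k)
  have d: "((\<lambda>x. f x *\<^sub>R g x) has_derivative (\<lambda>v. f x *\<^sub>R frechet_derivative g (at x) v
      + frechet_derivative f (at x) v *\<^sub>R g x)) (at x)" for x
    using Suc.prems by (auto intro!: has_derivative_scaleR simp: frechet_derivative_works)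
  then have "frechet_derivative (\<lambda>x. f x *\<^sub>R g x) (at x) v
      = f x *\<^sub>R frechet_derivative g (at x) v + frechet_derivative f (at x) v *\<^sub>R g x" for x v
    by (rule frechet_derivative_eq)
  moreover have "Ck_on k UNIV (\<lambda>x. f x *\<^sub>R frechet_derivative g (at x) v
      + frechet_derivative f (at x) v *\<^sub>R g x)" for v
    using Suc.prems Ck_on_SucD[OF Suc.prems(1)] Ck_on_SucD[OF Suc.prems(2)]
    by (intro Ck_on_add Suc.IH) auto
  ultimately show ?case using differentiableI[OF d] by simp
qed

lemma Ck_on_mult:
  fixes f :: "'a::euclidean_space \<Rightarrow> real"
  shows "Ck_on k UNIV f \<Longrightarrow> Ck_on k UNIV g \<Longrightarrow> Ck_on k UNIV (\<lambda>x. f x * g x)"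
  using Ck_on_scaleR[of k f g] by simp

lemma Ck_on_diff:
  "Ck_on k UNIV f \<Longrightarrow> Ck_on k UNIV g \<Longrightarrow> Ck_on k UNIV (\<lambda>x. f x - g x)"
  using Ck_on_add[of k f "\<lambda>x. (- 1) *\<^sub>R g x"] Ck_on_scaleR[OF Ck_on_const[of k UNIV "- 1"], of g] by simp

text \<open>The chain rule expresses the derivative as the same outer function times the derivative of
  \<open>f\<close>, so the induction on the order of differentiability closes. Sine and cosine share an induction
  because each occurs in the derivative of the other.\<close>

lemma Ck_on_exp:
  fixes f :: "'a::euclidean_space \<Rightarrow> real"
  shows "Ck_on k UNIV f \<Longrightarrow> Ck_on k UNIV (\<lambda>x. exp (f x))"
proof (induction k)
  case 0
  then show ?case by (auto intro: continuous_intros)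
next
  case (Suc k)
  have d: "((\<lambda>x. exp (f x)) has_derivative (\<lambda>v. exp (f x) * frechet_derivative f (at x) v)) (at x)" for x
    using Suc.prems by (auto intro!: derivative_eq_intros simp: frechet_derivative_works)
  then have "frechet_derivative (\<lambda>x. exp (f x)) (at x) v
      = exp (f x) * frechet_derivative f (at x) v" for x v
    by (rule frechet_derivative_eq)
  moreover have "Ck_on k UNIV (\<lambda>x. exp (f x) * frechet_derivative f (at x) v)" for v
    using Suc.prems Ck_on_SucD[OF Suc.prems] by (intro Ck_on_mult Suc.IH) auto
  ultimately show ?case using differentiableI[OF d] by simp
qed

lemma Ck_on_sin_cos:
  fixes f :: "'a::euclidean_space \<Rightarrow> real"
  shows "Ck_on k UNIV f \<Longrightarrow> Ck_on k UNIV (\<lambda>x. sin (f x)) \<and> Ck_on k UNIV (\<lambda>x. cos (f x))"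
proof (induction k)
  case 0
  then show ?case by (auto intro: continuous_intros)
next
  case (Suc k)
  have ds: "((\<lambda>x. sin (f x)) has_derivative (\<lambda>v. cos (f x) * frechet_derivative f (at x) v)) (at x)"
    and dc: "((\<lambda>x. cos (f x)) has_derivative (\<lambda>v. (-1) * (sin (f x) * frechet_derivative f (at x) v))) (at x)"
    for x
    using Suc.prems by (auto intro!: derivative_eq_intros simp: frechet_derivative_works)
  have "frechet_derivative (\<lambda>x. sin (f x)) (at x) v = cos (f x) * frechet_derivative f (at x) v"
    "frechet_derivative (\<lambda>x. cos (f x)) (at x) v = (-1) * (sin (f x) * frechet_derivative f (at x) v)"
    for x v
    by (rule frechet_derivative_eq[OF ds], rule frechet_derivative_eq[OF dc])
  moreover have "Ck_on k UNIV (\<lambda>x. cos (f x) * frechet_derivative f (at x) v)"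
    "Ck_on k UNIV (\<lambda>x. (-1) * (sin (f x) * frechet_derivative f (at x) v))" for v
    using Suc.prems Ck_on_SucD[OF Suc.prems] Suc.IH
    by (intro Ck_on_mult Ck_on_const; simp)+
  ultimately show ?case using differentiableI[OF ds] differentiableI[OF dc] by simp
qed

lemma Ck_on_affine:
  assumes "linear l"
  shows "Ck_on k UNIV f \<Longrightarrow> Ck_on k UNIV (\<lambda>x. f (l x + c))"
proof (induction k arbitrary: f)
  case 0
  then show ?case
    using continuous_on_compose2[of UNIV f UNIV "\<lambda>x. l x + c"]
      continuous_on_add[OF linear_continuous_on[of l UNIV] continuous_on_const[of UNIV c]] assms
    by (simp add: linear_linear)
next
  case (Suc k)
  have l: "((\<lambda>x. l x + c) has_derivative l) (at x)" for x
    using assms by (auto intro!: derivative_eq_intros linear_imp_has_derivative)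
  have d: "((\<lambda>x. f (l x + c)) has_derivative (\<lambda>v. frechet_derivative f (at (l x + c)) (l v))) (at x)" for x
    using has_derivative_compose[OF l, of f _ x] Suc.prems by (auto simp: frechet_derivative_works)
  then have "frechet_derivative (\<lambda>x. f (l x + c)) (at x) v = frechet_derivative f (at (l x + c)) (l v)" for x v
    by (rule frechet_derivative_eq)
  moreover have "Ck_on k UNIV (\<lambda>x. frechet_derivative f (at (l x + c)) (l v))" for v
    using Suc.IH[of "\<lambda>x. frechet_derivative f (at x) (l v)"] Suc.prems by simp
  ultimately show ?case using differentiableI[OF d] by simp
qed

section \<open>Groups whose left translations are affine\<close>

definition single_chart :: "('e::euclidean_space, 'e) chart" where
  "single_chart = (UNIV, id)"

lemma chart_inv_single [simp]: "chart_inv (single_chart :: ('e::euclidean_space, 'e) chart) = id"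
  by (auto simp: single_chart_def inv_id)

lemma single_chart_simps [simp]: "fst single_chart = UNIV" "snd single_chart = id"
  by (simp_all add: single_chart_def)

lemma second_countable_euclidean:
  "second_countable (euclidean :: 'a::euclidean_space topology)"
proof -
  obtain B :: "'a set set" where "countable B" "\<And>C. C \<in> B \<Longrightarrow> open C"
    "\<And>S. open S \<Longrightarrow> \<exists>U. U \<subseteq> B \<and> S = \<Union>U"
    using univ_second_countable by metis
  then show ?thesis unfolding second_countable_def
    by (intro exI[of _ B]) (fastforce simp: open_openin[symmetric])
qed

lemma connected_euclidean: "connected_space (euclidean :: 'a::euclidean_space topology)"
  using connectedin_topspace[of "euclidean :: 'a topology"] connected_UNIV[where 'a = 'a]
  by (simp del: connectedin_topspace connected_UNIV)

lemma simply_connected_euclidean: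
  "simply_connected_space (euclidean :: 'a::euclidean_space topology)"
  unfolding simply_connected_space_def
proof (intro allI impI)
  fix p q :: "real \<Rightarrow> 'a"
  assume *: "pathin euclidean p \<and> p 1 = p 0 \<and> pathin euclidean q \<and> q 1 = q 0"
  then have c: "continuous_on {0..1} p" "continuous_on {0..1} q"
    by (simp_all add: pathin_def)
  show "homotopic_with (\<lambda>r. r 1 = r 0) (top_of_set {0..1}) euclidean p q"
  proof -
    let ?h = "\<lambda>z. (1 - fst z) *\<^sub>R p (snd z) + fst z *\<^sub>R q (snd z)"
    have "continuous_on ({0..1} \<times> {0..1}) ?h"
      by (intro continuous_intros continuous_on_compose2[OF c(1)] continuous_on_compose2[OF c(2)]) auto
    then show ?thesis unfolding homotopic_with_def using *
      by (intro exI[of _ ?h]) (auto simp flip: subtopology_Times simp: euclidean_product_topology)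
  qed
qed

text \<open>A Euclidean space with one global chart, and the product \<open>p * q = p + A p q\<close>. Associativity
  of such a product amounts to \<open>A\<close> being a homomorphism into the linear group, and the differential
  of the left translation by \<open>p\<close> is \<open>A p\<close> at every point.\<close>

locale affine_group =
  fixes A :: "'e::euclidean_space \<Rightarrow> 'e \<Rightarrow> 'e" and inve :: "'e \<Rightarrow> 'e"
  assumes lin: "linear (A p)"
    and hom: "A (p + A p q) v = A p (A q v)"
    and A_zero: "A 0 v = v"
    and inve: "p + A p (inve p) = 0"
    and smooth_A: "Ck_on k UNIV (\<lambda>z. A (fst z) (snd z))"
    and smooth_inve: "Ck_on k UNIV inve"
begin

definition grp :: "('e, 'e) lie_grp" where
  "grp = \<lparr> carrier = UNIV, monoid.mult = (\<lambda>p q. p + A p q), one = 0,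
           gtop = euclidean, atlas = {single_chart} \<rparr>"

lemma grp_simps [simp]:
  "carrier grp = UNIV" "monoid.mult grp p q = p + A p q" "one grp = 0"
  "gtop grp = euclidean" "atlas grp = {single_chart}"
  by (simp_all add: grp_def)

lemma A_0 [simp]: "A p 0 = 0"
  using lin linear_0 by blast

text \<open>Where every element of a monoid has a right inverse, right inverses are two-sided: multiply \<open>p\<close> by \<open>inve p * inve (inve p) = 0\<close>.\<close>

lemma inve_inve: "inve (inve p) = p"
proof -
  have "p + A p (inve p + A (inve p) (inve (inve p))) = inve (inve p)"
    using inve[of p] hom[of p "inve p" "inve (inve p)"]
    by (simp add: linear_add[OF lin] A_zero flip: add.assoc)
  then show ?thesis by (simp add: inve)
qed

lemma inve_left: "inve p + A (inve p) p = 0"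
  using inve[of "inve p"] by (simp add: inve_inve)

lemma A_inverse: "A p (A (inve p) v) = v" "A (inve p) (A p v) = v"
  using hom[of p "inve p" v] hom[of "inve p" p v] by (simp_all add: inve inve_left A_zero)

lemma group_grp: "group grp"
proof (rule groupI)
  fix x assume "x \<in> carrier grp"
  show "\<exists>y\<in>carrier grp. y \<otimes>\<^bsub>grp\<^esub> x = \<one>\<^bsub>grp\<^esub>"
    using inve_left[of x] by auto
qed (auto simp: linear_add[OF lin] hom A_zero)

lemma inv_grp: "m_inv grp = inve"
proof
  fix p
  show "m_inv grp p = inve p"
    using group.inv_equality[OF group_grp, of "inve p" p] inve_left by simp
qed

lemma smooth_A_field: "Ck_on k UNIV (\<lambda>p. A p v)"
  using Ck_on_affine[OF _ smooth_A, where l = "\<lambda>p. (p, 0)" and c = "(0, v)"]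
  by (simp add: linear_iff)

lemma A_field_diff: "(\<lambda>p. A p v) differentiable (at q)"
  using smooth_A_field[of 1 v] by simp

lemma smooth_manifold_grp:
  "smooth_manifold (gtop grp) (atlas grp)"
  by (auto simp: smooth_manifold_def second_countable_euclidean smooth_on_def Ck_on_linear
      linear_id)

lemma lie_group_grp: "lie_group grp"
proof -
  let ?k = "(UNIV \<times> UNIV, map_prod id id) :: ('e \<times> 'e, 'e \<times> 'e) chart"
  have m: "smooth_on UNIV (\<lambda>z. fst z + A (fst z) (snd z))"
    unfolding smooth_on_def by (intro allI Ck_on_add smooth_A Ck_on_linear linear_fst)
  then have c: "continuous_on UNIV (\<lambda>z. fst z + A (fst z) (snd z))"
    using Ck_on.simps(1) unfolding smooth_on_def by blast
  have i: "continuous_on UNIV inve"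
    using smooth_inve[of 0] by simp
  have k: "prod_atlas {single_chart} {single_chart} = {?k}"
    by (simp add: prod_atlas_def)
  have ci: "chart_inv ?k = id"
    by (simp add: map_prod.id inv_id)
  have "smooth_map (prod_topology (gtop grp) (gtop grp)) (prod_atlas (atlas grp) (atlas grp))
       (gtop grp) (atlas grp) (\<lambda>(p, q). monoid.mult grp p q)"
    unfolding smooth_map_def grp_simps k using m c ci
    by (simp add: euclidean_product_topology case_prod_beta' comp_def map_prod.id)
  moreover have "smooth_map (gtop grp) (atlas grp) (gtop grp) (atlas grp) (m_inv grp)"
    unfolding smooth_map_def inv_grp using i smooth_inve by (simp add: smooth_on_def)
  ultimately show ?thesis
    using smooth_manifold_grp group_grp by (simp add: lie_group_def)
qed

text \<open>The map \<open>\<psi>\<close> identifies a Lie algebra, on an arbitrary type, with the tangent space at the unit.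
  The chart is ignored since there is only one.\<close>

definition field :: "('a \<Rightarrow> 'e) \<Rightarrow> 'a \<Rightarrow> ('e, 'e) field" where
  "field \<psi> x k p = A p (\<psi> x)"

lemma frechet_translation: "frechet_derivative (\<lambda>q. h + A h q) (at p) = A h"
proof -
  have "((\<lambda>q. h + A h q) has_derivative A h) (at p)"
    using lin by (auto intro!: derivative_eq_intros linear_imp_has_derivative)
  then show ?thesis by (intro ext frechet_derivative_eq)
qed

lemma left_invariant_field_grp:
  "left_invariant_field grp (field \<psi> x)"
  using smooth_A_field frechet_translation
  by (simp add: left_invariant_field_def vector_field_def smooth_on_def differential_def
      field_def comp_def hom frechet_derivative_id)

lemma left_invariant_field_grpD:
  assumes "left_invariant_field grp X"
  shows "X single_chart p = A p (X single_chart 0)"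
proof -
  have "X single_chart (p + A p 0) = frechet_derivative (\<lambda>q. p + A p q) (at 0) (X single_chart 0)"
    using assms by (auto simp: left_invariant_field_def differential_def comp_def dest!: spec[of _ p] spec[of _ 0] simp del: A_0)
  then show ?thesis by (simp add: frechet_translation)
qed

text \<open>Both sides are the derivative at \<open>q = 0\<close> of \<open>A (p + A p q) w = A p (A q w)\<close>. Thus brackets of
  left-invariant fields only need to be computed at the unit.\<close>

lemma frechet_A:
  "frechet_derivative (\<lambda>q. A q w) (at p) (A p v) = A p (frechet_derivative (\<lambda>q. A q w) (at 0) v)"
proof -
  have t: "((\<lambda>q. p + A p q) has_derivative A p) (at 0)"
    using lin by (auto intro!: derivative_eq_intros linear_imp_has_derivative)
  have "((\<lambda>q. A q w) has_derivative frechet_derivative (\<lambda>q. A q w) (at p)) (at (p + A p 0))"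
    using A_field_diff by (simp add: frechet_derivative_works)
  from has_derivative_compose[OF t this]
  have "((\<lambda>q. A p (A q w)) has_derivative (\<lambda>v. frechet_derivative (\<lambda>q. A q w) (at p) (A p v))) (at 0)"
    by (simp add: hom)
  moreover have "((\<lambda>q. A p (A q w)) has_derivative (\<lambda>v. A p (frechet_derivative (\<lambda>q. A q w) (at 0) v))) (at 0)"
    using A_field_diff[of w 0] lin[of p]
    by (intro bounded_linear.has_derivative[of "A p"])
      (simp_all add: frechet_derivative_works linear_linear)
  ultimately show ?thesis
    by (metis (no_types, lifting) has_derivative_unique)
qed

lemma corresponding_group_grp:
  fixes \<psi> :: "'a::real_vector \<Rightarrow> 'e"
  assumes "linear \<psi>" "bij \<psi>"
    and "\<And>x y. \<psi> (br x y) = frechet_derivative (\<lambda>q. A q (\<psi> y)) (at 0) (\<psi> x)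
          - frechet_derivative (\<lambda>q. A q (\<psi> x)) (at 0) (\<psi> y)"
  shows "corresponding_group grp (field \<psi>) br"
proof -
  have "\<exists>!x. X single_chart 0 = \<psi> x" for X :: "('e, 'e) field"
    using assms(2) by (metis bij_pointE)
  then have "\<exists>!x. \<forall>p. X single_chart p = A p (\<psi> x)" if "left_invariant_field grp X" for X
    using left_invariant_field_grpD[OF that] A_zero by metis
  moreover have "linear (\<lambda>x. A p (\<psi> x))" for p
    using linear_compose[OF assms(1) lin] by (simp add: comp_def)
  ultimately have "lie_algebra_of grp (field \<psi>) br"
    unfolding lie_algebra_of_def
    using left_invariant_field_grp[of \<psi>]
    by (simp add: field_def field_bracket_def comp_def frechet_A assms(3)
        linear_diff[OF lin])
  then show ?thesis
    by (simp add: corresponding_group_def lie_group_grp simply_connected_euclidean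
        connected_euclidean)
qed

lemma maurer_cartan_grp:
  assumes "bij \<psi>"
  shows "maurer_cartan (field \<psi>) k p (A p (\<psi> x)) = x"
proof -
  have "inj (\<lambda>x. A p (\<psi> x))"
    using assms by (intro injI) (metis A_inverse(2) bij_pointE)
  then show ?thesis
    using inv_f_f[of "\<lambda>x. A p (\<psi> x)" x] by (simp add: maurer_cartan_def field_def)
qed

end

section \<open>Five-dimensional solvable groups\<close>

lemma forall_5: "(\<forall>i::5. P i) \<longleftrightarrow> P 1 \<and> P 2 \<and> P 3 \<and> P 4 \<and> P 5"
proof -
  have "i = 1 \<or> i = 2 \<or> i = 3 \<or> i = 4 \<or> i = 5" for i :: 5
  proof (induct i)
    case (of_int z)
    then have "z = 0 \<or> z = 1 \<or> z = 2 \<or> z = 3 \<or> z = 4" by fastforce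
    then show ?case by auto
  qed
  then show ?thesis by metis
qed

text \<open>A sum of scaled basis vectors rather than a \<open>\<chi>\<close>-abstraction, so that rules for differentiating
  sums and products apply to it.\<close>

definition vec5 :: "real \<Rightarrow> real \<Rightarrow> real \<Rightarrow> real \<Rightarrow> real \<Rightarrow> real ^ 5" where
  "vec5 a b c d e = a *\<^sub>R axis 1 1 + b *\<^sub>R axis 2 1 + c *\<^sub>R axis 3 1 + d *\<^sub>R axis 4 1 + e *\<^sub>R axis 5 1"

lemma vec5_nth [simp]:
  "vec5 a b c d e $ 1 = a" "vec5 a b c d e $ 2 = b" "vec5 a b c d e $ 3 = c"
  "vec5 a b c d e $ 4 = d" "vec5 a b c d e $ 5 = e"
  by (simp_all add: vec5_def axis_def)

lemma vec5_eqI: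
  "x $ 1 = y $ 1 \<Longrightarrow> x $ 2 = y $ 2 \<Longrightarrow> x $ 3 = y $ 3 \<Longrightarrow> x $ 4 = y $ 4 \<Longrightarrow> x $ 5 = y $ 5 \<Longrightarrow> x = (y :: real ^ 5)"
  by (simp add: vec_eq_iff forall_5)

lemma Ck_on_vec5:
  fixes f1 :: "'a::euclidean_space \<Rightarrow> real"
  shows "Ck_on k UNIV f1 \<Longrightarrow> Ck_on k UNIV f2 \<Longrightarrow> Ck_on k UNIV f3 \<Longrightarrow> Ck_on k UNIV f4 \<Longrightarrow>
    Ck_on k UNIV f5 \<Longrightarrow> Ck_on k UNIV (\<lambda>x. vec5 (f1 x) (f2 x) (f3 x) (f4 x) (f5 x))"
  unfolding vec5_def by (intro Ck_on_add Ck_on_scaleR Ck_on_const)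

text \<open>The entry of \<open>exp (t ad e\<^sub>5)\<close> that maps \<open>e\<^sub>3\<close> to a multiple of \<open>e\<^sub>4\<close>, that is, the integral of
  \<open>-2\<tau> exp (l s)\<close> over \<open>s\<close> from \<open>0\<close> to \<open>t\<close>.\<close>

definition shear :: "real \<Rightarrow> real \<Rightarrow> real \<Rightarrow> real" where
  "shear \<tau> l t = (if l = 0 then - 2 * \<tau> * t else - 2 * \<tau> * (exp (l * t) - 1) / l)"

text \<open>The linear part of the left translation by \<open>q = (n, t)\<close>: the map \<open>exp (t ad e\<^sub>5)\<close>, followed by the
  left translation by \<open>n\<close> in the nilpotent ideal. In exponential coordinates the latter adds half
  the bracket with \<open>n\<close>, which is where the area form of the first two coordinates appears:
  \<open>[e\<^sub>1, e\<^sub>2] = -2\<tau>p e\<^sub>3 + 2 e\<^sub>4\<close>.\<close>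

definition transl :: "real \<Rightarrow> real \<Rightarrow> real \<Rightarrow> real \<Rightarrow> real ^ 5 \<Rightarrow> real ^ 5 \<Rightarrow> real ^ 5" where
  "transl \<tau> p r l q v =
     (let t = q $ 5; a = exp (p * t) * (cos (r * t) * v $ 1 - sin (r * t) * v $ 2);
          b = exp (p * t) * (sin (r * t) * v $ 1 + cos (r * t) * v $ 2);
          w = q $ 1 * b - q $ 2 * a
      in vec5 a b (exp (l * t) * v $ 3 - \<tau> * p * w) (v $ 4 + shear \<tau> l t * v $ 3 + w) (v $ 5))"

text \<open>The inverse of \<open>(n, t)\<close> is \<open>(- exp (-t ad e\<^sub>5) n, -t)\<close>.\<close>

definition transl_inv :: "real \<Rightarrow> real \<Rightarrow> real \<Rightarrow> real \<Rightarrow> real ^ 5 \<Rightarrow> real ^ 5" where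
  "transl_inv \<tau> p r l q = - transl \<tau> p r l (vec5 0 0 0 0 (- (q $ 5))) q"

text \<open>The Lie algebra of the frame \<open>w, \<epsilon> \<phi> w, b, \<xi>, e\<^sub>0\<close>; the rotation of the plane of \<open>e\<^sub>1, e\<^sub>2\<close> has speed
  \<open>r\<close>. It contains the three models, with \<open>r = 0\<close>.\<close>

definition solv_bracket :: "real \<Rightarrow> real \<Rightarrow> real \<Rightarrow> real \<Rightarrow> real ^ 5 \<Rightarrow> real ^ 5 \<Rightarrow> real ^ 5" where
  "solv_bracket \<tau> p r l = bracket5
     (\<lambda>x y. p * e2 1 5 x y - r * e2 2 5 x y)
     (\<lambda>x y. r * e2 1 5 x y + p * e2 2 5 x y)
     (\<lambda>x y. 2 * \<tau> * p * e2 1 2 x y + l * e2 3 5 x y)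
     (\<lambda>x y. - 2 * e2 1 2 x y - 2 * \<tau> * e2 3 5 x y) (\<lambda>x y. 0)"

lemma solv_bracket_nth:
  "solv_bracket \<tau> p r l x y $ 1 = r * e2 2 5 x y - p * e2 1 5 x y"
  "solv_bracket \<tau> p r l x y $ 2 = - r * e2 1 5 x y - p * e2 2 5 x y"
  "solv_bracket \<tau> p r l x y $ 3 = - 2 * \<tau> * p * e2 1 2 x y - l * e2 3 5 x y"
  "solv_bracket \<tau> p r l x y $ 4 = 2 * e2 1 2 x y + 2 * \<tau> * e2 3 5 x y"
  "solv_bracket \<tau> p r l x y $ 5 = 0"
  by (simp_all add: solv_bracket_def bracket5_def)

lemma models:
  "model1 \<tau> = solv_bracket \<tau> 0 0 0" "model2 \<tau> = solv_bracket \<tau> 0 0 2" "model3 \<tau> = solv_bracket \<tau> 1 0 2"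
  by (simp_all add: model1_def model2_def model3_def solv_bracket_def fun_eq_iff)

lemma shear_add: "shear \<tau> l (s + t) = shear \<tau> l s + shear \<tau> l t * exp (l * s)"
  by (cases "l = 0") (simp_all add: shear_def ring_distribs exp_add diff_divide_distrib)

text \<open>This says that \<open>exp (t ad e\<^sub>5)\<close> maps \<open>[e\<^sub>1, e\<^sub>2] = -2\<tau>p e\<^sub>3 + 2 e\<^sub>4\<close> to \<open>exp (2pt)\<close> times itself, in the
  component along \<open>e\<^sub>4\<close>.\<close>

lemma shear_exp:
  assumes "\<tau>\<^sup>2 = 1" "p * (l - 2 * p) = 0"
  shows "1 - \<tau> * p * shear \<tau> l t = exp (p * t) * exp (p * t)"
proof (cases "p = 0")
  case False
  with assms have l: "l = 2 * p" by simp
  have "1 - \<tau> * p * shear \<tau> l t = 1 + \<tau>\<^sup>2 * (exp (2 * p * t) - 1)"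
    using False by (simp add: l shear_def power2_eq_square field_simps)
  then show ?thesis
    by (simp add: assms(1) flip: exp_add)
qed simp

lemma transl_nth:
  "transl \<tau> p r l q v $ 1 = exp (p * q $ 5) * (cos (r * q $ 5) * v $ 1 - sin (r * q $ 5) * v $ 2)"
  "transl \<tau> p r l q v $ 2 = exp (p * q $ 5) * (sin (r * q $ 5) * v $ 1 + cos (r * q $ 5) * v $ 2)"
  "transl \<tau> p r l q v $ 3 = exp (l * q $ 5) * v $ 3
     - \<tau> * p * (q $ 1 * transl \<tau> p r l q v $ 2 - q $ 2 * transl \<tau> p r l q v $ 1)"
  "transl \<tau> p r l q v $ 4 = v $ 4 + shear \<tau> l (q $ 5) * v $ 3
     + (q $ 1 * transl \<tau> p r l q v $ 2 - q $ 2 * transl \<tau> p r l q v $ 1)"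
  "transl \<tau> p r l q v $ 5 = v $ 5"
  by (simp_all add: transl_def Let_def)

text \<open>The area form of the first two coordinates is scaled by the determinant of \<open>exp (t ad e\<^sub>5)\<close> on
  that plane.\<close>

lemma transl_area:
  "transl \<tau> p r l q x $ 1 * transl \<tau> p r l q y $ 2 - transl \<tau> p r l q x $ 2 * transl \<tau> p r l q y $ 1
     = (exp (p * q $ 5))\<^sup>2 * (x $ 1 * y $ 2 - x $ 2 * y $ 1)"
proof -
  have *: "(e * (c * x1 - s * x2)) * (e * (s * y1 + c * y2)) - (e * (s * x1 + c * x2)) * (e * (c * y1 - s * y2))
      = e\<^sup>2 * ((s\<^sup>2 + c\<^sup>2) * (x1 * y2 - x2 * y1))" for e c s x1 x2 y1 y2 :: real
    by algebra
  show ?thesis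
    unfolding transl_nth(1,2) * by simp
qed

text \<open>On the first two coordinates the maps \<open>A q\<close> are rotations times dilations, and the claim is the
  addition theorem for them. The other two coordinates carry the area form, whose value on the
  rotated vectors is multiplied by \<open>exp (2pt)\<close>; this factor agrees with the action of
  \<open>exp (t ad e\<^sub>5)\<close> on \<open>e\<^sub>3, e\<^sub>4\<close> exactly because \<open>ad e\<^sub>5\<close> is a derivation, which is the hypothesis
  \<open>p (l - 2p) = 0\<close>.\<close>

lemma transl_hom:
  assumes "\<tau>\<^sup>2 = 1" "p * (l - 2 * p) = 0"
  shows "transl \<tau> p r l (q + transl \<tau> p r l q q') v = transl \<tau> p r l q (transl \<tau> p r l q' v)"
proof -
  let ?A = "transl \<tau> p r l" let ?L = "?A (q + ?A q q') v" and ?R = "?A q (?A q' v)"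
  have 1: "?L $ 1 = ?R $ 1" and 2: "?L $ 2 = ?R $ 2"
    by (simp_all add: transl_nth(1,2,5) algebra_simps exp_add sin_add cos_add)
  let ?w = "q' $ 1 * ?A q' v $ 2 - q' $ 2 * ?A q' v $ 1"
  have w: "(q + ?A q q') $ 1 * ?L $ 2 - (q + ?A q q') $ 2 * ?L $ 1
      = (q $ 1 * ?R $ 2 - q $ 2 * ?R $ 1) + (exp (p * q $ 5))\<^sup>2 * ?w"
    using transl_area[of \<tau> p r l q q' "?A q' v"] unfolding 1 2 by (simp add: algebra_simps)
  show ?thesis
  proof (rule vec5_eqI)
    let ?e = "(exp (p * q $ 5))\<^sup>2" and ?W = "q $ 1 * ?R $ 2 - q $ 2 * ?R $ 1"
    have e: "p * ?e = p * exp (l * q $ 5)"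
    proof (cases "p = 0")
      case False
      with assms have "l = 2 * p" by simp
      then show ?thesis by (simp add: power2_eq_square flip: exp_add)
    qed simp
    have "?L $ 3 = exp (l * q $ 5) * exp (l * q' $ 5) * v $ 3 - \<tau> * p * ?W - \<tau> * (p * ?e) * ?w"
      unfolding transl_nth(3)[of \<tau> p r l "q + ?A q q'" v] w
      by (simp add: transl_nth(5) exp_add ring_distribs)
    also have "\<dots> = ?R $ 3"
      unfolding e transl_nth(3)[of \<tau> p r l q "?A q' v"] transl_nth(3)[of \<tau> p r l q' v]
      by (simp add: ring_distribs)
    finally show "?L $ 3 = ?R $ 3" .
    have e: "?e = 1 - \<tau> * p * shear \<tau> l (q $ 5)"
      by (simp add: shear_exp[OF assms] power2_eq_square)
    have "?L $ 4 = v $ 4 + (shear \<tau> l (q' $ 5) + shear \<tau> l (q $ 5) * exp (l * q' $ 5)) * v $ 3 + ?W + ?e * ?w"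
      unfolding transl_nth(4)[of \<tau> p r l "q + ?A q q'" v] w
      by (simp add: transl_nth(5) shear_add[of \<tau> l "q' $ 5" "q $ 5"] add.commute[of "q $ 5"])
    also have "\<dots> = ?R $ 4"
      unfolding e transl_nth(4)[of \<tau> p r l q "?A q' v"] transl_nth(4)[of \<tau> p r l q' v]
        transl_nth(3)[of \<tau> p r l q' v]
      by (simp add: ring_distribs)
    finally show "?L $ 4 = ?R $ 4" .
  qed (simp_all add: 1 2 transl_nth(5))
qed

lemma linear_transl: "linear (transl \<tau> p r l q)"
  by (rule linearI; rule vec5_eqI; simp add: transl_def Let_def algebra_simps)

lemma transl_zero: "transl \<tau> p r l 0 v = v"
  by (rule vec5_eqI; simp add: transl_def Let_def shear_def)

lemma transl_inv:
  assumes "\<tau>\<^sup>2 = 1" "p * (l - 2 * p) = 0"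
  shows "q + transl \<tau> p r l q (transl_inv \<tau> p r l q) = 0"
proof -
  let ?A = "transl \<tau> p r l" and ?z = "vec5 0 0 0 0 (- (q $ 5))"
  have "?A q (?A ?z q) = ?A (q + ?A q ?z) q"
    by (simp add: transl_hom[OF assms])
  also have "\<dots> = q"
    by (rule vec5_eqI; simp add: transl_def Let_def shear_def)
  finally show ?thesis
    by (simp add: transl_inv_def linear_neg[OF linear_transl])
qed

lemma smooth_shear: "Ck_on k UNIV f \<Longrightarrow> Ck_on k UNIV (\<lambda>x. shear \<tau> l (f x))"
proof (cases "l = 0")
  case True
  assume "Ck_on k UNIV f"
  then have "Ck_on k UNIV (\<lambda>x. (- 2 * \<tau>) * f x)"
    by (intro Ck_on_mult Ck_on_const)
  with True show ?thesis by (simp add: shear_def)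
next
  case False
  assume "Ck_on k UNIV f"
  then have "Ck_on k UNIV (\<lambda>x. (- 2 * \<tau> / l) * (exp (l * f x) - 1))"
    by (intro Ck_on_mult Ck_on_const Ck_on_diff Ck_on_exp)
  with False show ?thesis by (simp add: shear_def)
qed

lemma smooth_transl: "Ck_on k UNIV (\<lambda>z. transl \<tau> p r l (fst z) (snd z))"
proof -
  have c: "Ck_on k UNIV (\<lambda>z::(real^5)\<times>(real^5). fst z $ i)" "Ck_on k UNIV (\<lambda>z::(real^5)\<times>(real^5). snd z $ i)" for i
    by (auto intro!: Ck_on_linear linearI)
  have t: "Ck_on k UNIV (\<lambda>z::(real^5)\<times>(real^5). m * fst z $ 5)" for m
    by (intro Ck_on_mult Ck_on_const c)
  note e = Ck_on_exp[OF t] note S = conjunct1[OF Ck_on_sin_cos[OF t]] note C = conjunct2[OF Ck_on_sin_cos[OF t]]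
  have a: "Ck_on k UNIV (\<lambda>z. transl \<tau> p r l (fst z) (snd z) $ 1)"
    unfolding transl_nth by (intro Ck_on_mult Ck_on_diff e S C c)
  have b: "Ck_on k UNIV (\<lambda>z. transl \<tau> p r l (fst z) (snd z) $ 2)"
    unfolding transl_nth by (intro Ck_on_mult Ck_on_add e S C c)
  have w: "Ck_on k UNIV (\<lambda>z. fst z $ 1 * transl \<tau> p r l (fst z) (snd z) $ 2
      - fst z $ 2 * transl \<tau> p r l (fst z) (snd z) $ 1)"
    by (intro Ck_on_mult Ck_on_diff a b c)
  have d: "Ck_on k UNIV (\<lambda>z. transl \<tau> p r l (fst z) (snd z) $ 3)"
    unfolding transl_nth(3) by (intro Ck_on_diff Ck_on_mult[OF e c(2)] Ck_on_mult[OF Ck_on_const w])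
  have f: "Ck_on k UNIV (\<lambda>z. transl \<tau> p r l (fst z) (snd z) $ 4)"
    unfolding transl_nth(4) by (intro Ck_on_add w c Ck_on_mult[OF smooth_shear[OF c(1)] c(2)])
  have g: "Ck_on k UNIV (\<lambda>z. transl \<tau> p r l (fst z) (snd z) $ 5)"
    unfolding transl_nth(5) by (rule c)
  have "transl \<tau> p r l q v = vec5 (transl \<tau> p r l q v $ 1) (transl \<tau> p r l q v $ 2)
      (transl \<tau> p r l q v $ 3) (transl \<tau> p r l q v $ 4) (transl \<tau> p r l q v $ 5)" for q v
    by (rule vec5_eqI; simp only: vec5_nth)
  then show ?thesis
    using Ck_on_vec5[OF a b d f g] by presburger
qed

lemma smooth_transl_inv: "Ck_on k UNIV (transl_inv \<tau> p r l)"
proof -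
  have "linear (\<lambda>q. (vec5 0 0 0 0 (- (q $ 5)), q))"
    by (auto intro!: linearI vec5_eqI)
  from Ck_on_scaleR[OF Ck_on_const[of k UNIV "- 1"] Ck_on_affine[OF this smooth_transl[of k \<tau> p r l], of 0]]
  show ?thesis by (simp add: transl_inv_def[abs_def])
qed

lemma frechet_transl:
  "frechet_derivative (\<lambda>q. transl \<tau> p r l q w) (at 0) v =
     vec5 (v $ 5 * (p * w $ 1 - r * w $ 2)) (v $ 5 * (r * w $ 1 + p * w $ 2))
       (l * (v $ 5 * w $ 3) - \<tau> * p * (v $ 1 * w $ 2 - v $ 2 * w $ 1))
       (- 2 * \<tau> * (v $ 5 * w $ 3) + (v $ 1 * w $ 2 - v $ 2 * w $ 1)) 0"
proof (rule frechet_derivative_eq)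
  have n: "((\<lambda>q::real^5. q $ i) has_derivative (\<lambda>v. v $ i)) F" for i F
    by (intro linear_imp_has_derivative linearI) auto
  have "((\<lambda>q::real^5. shear \<tau> l (q $ 5)) has_derivative (\<lambda>v. - 2 * \<tau> * v $ 5)) (at 0)"
    by (cases "l = 0") (auto simp: shear_def intro!: derivative_eq_intros n)
  note d = derivative_eq_intros n this
  show "((\<lambda>q. transl \<tau> p r l q w) has_derivative (\<lambda>v.
     vec5 (v $ 5 * (p * w $ 1 - r * w $ 2)) (v $ 5 * (r * w $ 1 + p * w $ 2))
       (l * (v $ 5 * w $ 3) - \<tau> * p * (v $ 1 * w $ 2 - v $ 2 * w $ 1))
       (- 2 * \<tau> * (v $ 5 * w $ 3) + (v $ 1 * w $ 2 - v $ 2 * w $ 1)) 0)) (at 0)"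
    unfolding transl_def Let_def vec5_def
    by ((rule d refl)+) (simp add: fun_eq_iff vec_eq_iff forall_5 axis_def algebra_simps)
qed

lemma transl_bracket:
  "frechet_derivative (\<lambda>q. transl \<tau> p r l q y) (at 0) x - frechet_derivative (\<lambda>q. transl \<tau> p r l q x) (at 0) y
     = solv_bracket \<tau> p r l x y"
  by (rule vec5_eqI; simp add: frechet_transl solv_bracket_nth e2_def algebra_simps)

lemma affine_group_transl:
  assumes "\<tau>\<^sup>2 = 1" "p * (l - 2 * p) = 0"
  shows "affine_group (transl \<tau> p r l) (transl_inv \<tau> p r l)"
  by (rule affine_group.intro)
    (rule linear_transl transl_hom[OF assms] transl_zero transl_inv[OF assms] smooth_transl smooth_transl_inv)+

definition rot :: "real \<Rightarrow> real ^ 5 \<Rightarrow> real ^ 5" where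
  "rot s v = vec5 (cos s * v $ 1 - sin s * v $ 2) (sin s * v $ 1 + cos s * v $ 2) (v $ 3) (v $ 4) (v $ 5)"

text \<open>The rotation part of the flow of \<open>ad e\<^sub>5\<close> can be applied first, since it commutes with the rest of
  the flow; the remaining factor is the translation of the group with \<open>r = 0\<close>.\<close>

lemma transl_rot: "transl \<tau> p r l q v = transl \<tau> p 0 l q (rot (r * q $ 5) v)"
  by (simp add: transl_def Let_def rot_def)


section \<open>The isometry\<close>

text \<open>The endomorphism is determined by the metric and by \<open>\<Phi> = -e\<^sup>1\<^sup>2 - \<tau> e\<^sup>3\<^sup>5\<close>: it maps \<open>e\<^sub>1\<close> to \<open>\<epsilon> e\<^sub>2\<close> and
  \<open>e\<^sub>3\<close> to \<open>e\<^sub>5\<close>.\<close>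

definition model_structure :: "real \<Rightarrow> real \<Rightarrow> (real ^ 5) contact_metric" where
  "model_structure \<epsilon> \<tau> =
     \<lparr> cm_phi = (\<lambda>v. vec5 (- \<epsilon> * v $ 2) (\<epsilon> * v $ 1) (- (v $ 5)) 0 (v $ 3)),
       cm_xi = axis 4 1,
       cm_eta = (\<lambda>v. v $ 4),
       cm_met = model_metric \<epsilon> \<tau> \<rparr>"

lemma model_structure_simps [simp]:
  "cm_phi (model_structure \<epsilon> \<tau>) v = vec5 (- \<epsilon> * v $ 2) (\<epsilon> * v $ 1) (- (v $ 5)) 0 (v $ 3)"
  "cm_xi (model_structure \<epsilon> \<tau>) = axis 4 1"
  "cm_eta (model_structure \<epsilon> \<tau>) v = v $ 4"
  "cm_met (model_structure \<epsilon> \<tau>) = model_metric \<epsilon> \<tau>"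
  by (simp_all add: model_structure_def)

lemma axis_4_nth [simp]:
  "axis (4::5) 1 $ (1::5) = 0" "axis (4::5) 1 $ (2::5) = 0" "axis (4::5) 1 $ (3::5) = 0"
  "axis (4::5) (1::real) $ (4::5) = 1" "axis (4::5) 1 $ (5::5) = (0::real)"
  by (simp_all add: axis_def)

lemma model_fundamental_form:
  assumes "\<epsilon> \<in> {1, -1}"
  shows "fundamental_form (model_structure \<epsilon> \<tau>) x y = - e2 1 2 x y - \<tau> * e2 3 5 x y"
  using assms by (auto simp: fundamental_form_def model_metric_def e2_def algebra_simps)

lemma metric_form_model:
  assumes "\<epsilon> \<in> {1, -1}" "\<tau> \<in> {1, -1}"
  shows "metric_form (model_metric \<epsilon> \<tau>)"
proof -
  have "bilinear (model_metric \<epsilon> \<tau>)"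
    by (auto simp: bilinear_def model_metric_def algebra_simps intro!: linearI)
  moreover have "x = 0" if "\<forall>y. model_metric \<epsilon> \<tau> x y = 0" for x
    using assms that[rule_format, of "vec5 1 0 0 0 0"] that[rule_format, of "vec5 0 1 0 0 0"]
      that[rule_format, of "vec5 0 0 1 0 0"] that[rule_format, of "vec5 0 0 0 1 0"]
      that[rule_format, of "vec5 0 0 0 0 1"]
    by (intro vec5_eqI) (auto simp: model_metric_def)
  ultimately show ?thesis
    by (auto simp: metric_form_def nondegenerate_on_def model_metric_def mult.commute)
qed

lemma almost_contact_model:
  assumes "\<epsilon> \<in> {1, -1}" "\<tau> \<in> {1, -1}"
  shows "almost_contact_metric (model_structure \<epsilon> \<tau>)"
proof -
  have "linear (cm_phi (model_structure \<epsilon> \<tau>))" "linear (cm_eta (model_structure \<epsilon> \<tau>))"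
    by (auto intro!: linearI vec5_eqI simp: algebra_simps)
  moreover have "cm_phi (model_structure \<epsilon> \<tau>) (cm_phi (model_structure \<epsilon> \<tau>) x)
      = - x + cm_eta (model_structure \<epsilon> \<tau>) x *\<^sub>R cm_xi (model_structure \<epsilon> \<tau>)" for x
    using assms by (intro vec5_eqI) auto
  ultimately show ?thesis
    unfolding almost_contact_metric_def
    using assms metric_form_model[OF assms] by (auto simp: model_metric_def algebra_simps)
qed

lemma lie_algebra_solv:
  assumes "p * (l - 2 * p) = 0" "\<tau>\<^sup>2 = 1"
  shows "lie_algebra (solv_bracket \<tau> p r l)"
proof -
  let ?b = "solv_bracket \<tau> p r l"
  have "bilinear ?b"
    unfolding bilinear_def
    by (intro allI conjI linearI vec5_eqI; simp add: solv_bracket_nth e2_def algebra_simps)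
  moreover have "?b x x = 0" for x
    by (intro vec5_eqI; simp add: solv_bracket_nth e2_def)
  moreover have "?b x (?b y z) + ?b y (?b z x) + ?b z (?b x y) = 0" for x y z
  proof (rule vec5_eqI)
    show "(?b x (?b y z) + ?b y (?b z x) + ?b z (?b x y)) $ 3 = 0 $ 3"
      "(?b x (?b y z) + ?b y (?b z x) + ?b z (?b x y)) $ 4 = 0 $ 4"
      using assms by (simp_all add: solv_bracket_nth e2_def; algebra)+
  qed (simp_all add: solv_bracket_nth e2_def algebra_simps)
  ultimately show ?thesis by (simp add: lie_algebra_def)
qed

lemma sasaki_model:
  assumes "\<epsilon> \<in> {1, -1}" "\<tau> \<in> {1, -1}"
  shows "sasaki (solv_bracket \<tau> p r l) (model_structure \<epsilon> \<tau>)"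
proof -
  have "ext_deriv (solv_bracket \<tau> p r l) (cm_eta (model_structure \<epsilon> \<tau>)) x y
      = 2 * fundamental_form (model_structure \<epsilon> \<tau>) x y" for x y
    by (simp add: model_fundamental_form[OF assms(1)] ext_deriv_def solv_bracket_nth)
  moreover have "nijenhuis (solv_bracket \<tau> p r l) (cm_phi (model_structure \<epsilon> \<tau>)) x y
      + ext_deriv (solv_bracket \<tau> p r l) (cm_eta (model_structure \<epsilon> \<tau>)) x y *\<^sub>R cm_xi (model_structure \<epsilon> \<tau>) = 0"
    for x y
    using assms
    by (intro vec5_eqI) (auto simp: nijenhuis_def ext_deriv_def solv_bracket_nth e2_def algebra_simps)
  ultimately show ?thesis
    by (simp add: sasaki_def almost_contact_model[OF assms])
qed

text \<open>By \<open>transl_rot\<close>, at each point the frames of the two groups differ by a rotation of the first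
  two coordinates. Such a rotation preserves the metric, \<open>\<phi>\<close>, \<open>\<xi>\<close> and \<open>\<eta>\<close> of the model, so both groups
  carry the same left-invariant tensors on \<open>\<real>\<^sup>5\<close> and the identity map preserves them.\<close>

lemma sasaki_isometric_solv:
  fixes \<psi> :: "'a::real_vector \<Rightarrow> real ^ 5"
  assumes \<tau>: "\<tau>\<^sup>2 = 1" and pl: "p * (l - 2 * p) = 0"
    and \<psi>: "linear \<psi>" "bij \<psi>"
    and br: "\<And>x y. \<psi> (br x y) = solv_bracket \<tau> p r l (\<psi> x) (\<psi> y)"
    and met: "\<And>x y. cm_met T x y = model_metric \<epsilon> \<tau> (\<psi> x) (\<psi> y)"
    and xi: "\<psi> (cm_xi T) = axis 4 1"
    and eta: "\<And>x. cm_eta T x = \<psi> x $ 4"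
    and phi: "\<And>x. \<psi> (cm_phi T x) = cm_phi (model_structure \<epsilon> \<tau>) (\<psi> x)"
  shows "sasaki_isometric br T (solv_bracket \<tau> p 0 l) (model_structure \<epsilon> \<tau>)"
proof -
  interpret G: affine_group "transl \<tau> p r l" "transl_inv \<tau> p r l"
    using affine_group_transl[OF \<tau> pl] .
  interpret H: affine_group "transl \<tau> p 0 l" "transl_inv \<tau> p 0 l"
    using affine_group_transl[OF \<tau> pl] .
  have G: "corresponding_group G.grp (G.field \<psi>) br"
    by (rule G.corresponding_group_grp) (simp_all add: \<psi> br transl_bracket)
  have H: "corresponding_group H.grp (H.field id) (solv_bracket \<tau> p 0 l)"
    by (rule H.corresponding_group_grp) (simp_all add: transl_bracket linear_id)
  have id: "differential single_chart single_chart id q = id" for q :: "real ^ 5"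
    by (simp add: differential_def frechet_derivative_id)
  have diffeo: "diffeomorphism G.grp H.grp id"
    by (simp add: diffeomorphism_def smooth_map_def smooth_on_def Ck_on_linear linear_id inv_id)
  have ex: "\<exists>x. u = transl \<tau> p r l q (\<psi> x)" for u q
    using G.A_inverse(1) \<psi>(2) by (metis bij_pointE)
  have mcG: "maurer_cartan (G.field \<psi>) k q (transl \<tau> p r l q (\<psi> x)) = x" for k q x
    by (rule G.maurer_cartan_grp[OF \<psi>(2)])
  have mcH: "maurer_cartan (H.field id) k q (transl \<tau> p r l q v) = rot (r * q $ 5) v" for k q v
    using H.maurer_cartan_grp[of id k q "rot (r * q $ 5) v"] by (simp flip: transl_rot)
  have rot_met: "model_metric \<epsilon> \<tau> (rot s v) (rot s w) = model_metric \<epsilon> \<tau> v w" for s v w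
  proof -
    have "(c * v1 - s * v2) * (c * w1 - s * w2) + (s * v1 + c * v2) * (s * w1 + c * w2)
      = (s\<^sup>2 + c\<^sup>2) * (v1 * w1 + v2 * w2)" for c s v1 v2 w1 w2 :: real by algebra
    then show ?thesis by (simp add: model_metric_def rot_def)
  qed
  have rot_phi: "cm_phi (model_structure \<epsilon> \<tau>) (rot s v) = rot s (cm_phi (model_structure \<epsilon> \<tau>) v)" for s v
    by (rule vec5_eqI; simp add: rot_def algebra_simps)
  have rot_xi: "rot s (axis 4 1) = axis 4 1" and rot_eta: "rot s v $ 4 = v $ 4" for s v
    by (rule vec5_eqI; simp add: rot_def) (simp add: rot_def)
  have "lie_group_isometry G.grp (G.field \<psi>) (cm_met T) H.grp (H.field id)
      (cm_met (model_structure \<epsilon> \<tau>)) id"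
    unfolding lie_group_isometry_def
  proof (intro conjI diffeo ballI impI allI)
    fix k l' q u v
    assume "k \<in> atlas G.grp" "l' \<in> atlas H.grp"
    then have [simp]: "k = single_chart" "l' = single_chart" by simp_all
    obtain x y where [simp]: "u = transl \<tau> p r l q (\<psi> x)" "v = transl \<tau> p r l q (\<psi> y)"
      using ex by metis
    show "left_invariant_metric (H.field id) (cm_met (model_structure \<epsilon> \<tau>)) l' (id q)
        (differential k l' id q u) (differential k l' id q v)
      = left_invariant_metric (G.field \<psi>) (cm_met T) k q u v"
      by (simp add: left_invariant_metric_def id mcG mcH rot_met met)
  qed
  moreover have "preserves_contact G.grp (G.field \<psi>) T H.grp (H.field id) (model_structure \<epsilon> \<tau>) id"
    unfolding preserves_contact_def
  proof (intro conjI ballI impI allI)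
    fix k l' q
    assume "k \<in> atlas G.grp" "l' \<in> atlas H.grp"
    then have [simp]: "k = single_chart" "l' = single_chart" by simp_all
    have "transl \<tau> p r l q (axis 4 1) = transl \<tau> p 0 l q (axis 4 1)"
      using transl_rot[of \<tau> p r l q "axis 4 1"] by (simp add: rot_xi)
    then show "differential k l' id q (G.field \<psi> (cm_xi T) k q) = H.field id (cm_xi (model_structure \<epsilon> \<tau>)) l' (id q)"
      by (simp add: id G.field_def H.field_def xi)
    fix u
    obtain x where [simp]: "u = transl \<tau> p r l q (\<psi> x)"
      using ex by metis
    show "left_invariant_one_form (H.field id) (cm_eta (model_structure \<epsilon> \<tau>)) l' (id q) (differential k l' id q u)
      = left_invariant_one_form (G.field \<psi>) (cm_eta T) k q u"
      by (simp add: left_invariant_one_form_def id mcG mcH rot_eta eta)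
    have "transl \<tau> p 0 l q (cm_phi (model_structure \<epsilon> \<tau>) (rot (r * q $ 5) (\<psi> x)))
        = transl \<tau> p r l q (\<psi> (cm_phi T x))"
      by (simp only: rot_phi phi transl_rot[of \<tau> p r])
    then show "left_invariant_endomorphism (H.field id) (cm_phi (model_structure \<epsilon> \<tau>)) l' (id q) (differential k l' id q u)
      = differential k l' id q (left_invariant_endomorphism (G.field \<psi>) (cm_phi T) k q u)"
      by (simp add: left_invariant_endomorphism_def id mcG mcH H.field_def G.field_def
          del: model_structure_simps)
  qed
  ultimately show ?thesis
    using G H unfolding sasaki_isometric_def by blast
qed

section \<open>Five-dimensional \<open>z\<close>-standard Sasaki Lie algebras\<close>

text \<open>A set whose elements are reproduced, up to scalars, by brackets with \<open>I\<close> lies in every term of the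
  lower central series.\<close>

lemma nilpotent_no_eigenspace:
  assumes "nilpotent_lie br I" "X \<subseteq> I"
    and "\<And>x. x \<in> X \<Longrightarrow> \<exists>y\<in>I. \<exists>z\<in>X. \<exists>n. x = n *\<^sub>R br y z"
  shows "X \<subseteq> {0}"
proof -
  have "X \<subseteq> lower_central br I n" for n
  proof (induction n)
    case (Suc n)
    show ?case
    proof
      fix x assume "x \<in> X"
      then obtain y z m where "y \<in> I" "z \<in> X" "x = m *\<^sub>R br y z" using assms(3) by blast
      moreover from this Suc have "br y z \<in> lower_central br I (Suc n)"
        by (auto intro!: span_base)
      ultimately show "x \<in> lower_central br I (Suc n)"
        by (simp add: span_scale)
    qed
  qed (simp add: assms(2))
  with assms(1) show ?thesis unfolding nilpotent_lie_def by blast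
qed

locale z_sasaki =
  fixes br :: "'a::real_vector \<Rightarrow> 'a \<Rightarrow> 'a" and S :: "'a contact_metric"
    and I :: "'a set" and e0 :: 'a and \<tau> :: real
  assumes lie: "lie_algebra br" and dim5: "dim (UNIV :: 'a set) = 5" and sasaki: "sasaki br S"
    and ideal: "lie_ideal br I" and nilpotent: "nilpotent_lie br I"
    and split: "\<And>x. \<exists>y\<in>I. \<exists>t. x = y + t *\<^sub>R e0"
    and nondeg_I: "nondegenerate_on I (cm_met S)"
    and \<tau>: "\<tau> \<in> {1, -1}"
    and met_split: "\<And>x y s t. x \<in> I \<Longrightarrow> y \<in> I \<Longrightarrow>
        cm_met S (x + s *\<^sub>R e0) (y + t *\<^sub>R e0) = cm_met S x y + \<tau> * s * t"
    and central: "- cm_phi S e0 \<in> lie_center br I"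
begin

abbreviation "\<phi> \<equiv> cm_phi S"
abbreviation "\<xi> \<equiv> cm_xi S"
abbreviation "\<eta> \<equiv> cm_eta S"
abbreviation "g \<equiv> cm_met S"
definition "b = - cm_phi S e0"

lemma almost_contact: "almost_contact_metric S"
  using sasaki by (simp add: sasaki_def)

lemma lin_phi: "linear \<phi>" and lin_eta: "linear \<eta>" and met: "metric_form g"
  and eta_xi: "\<eta> \<xi> = 1" and eta_phi: "\<eta> (\<phi> x) = 0"
  and phi_phi: "\<phi> (\<phi> x) = - x + \<eta> x *\<^sub>R \<xi>"
  and eta_met: "\<eta> x = g \<xi> x"
  and met_phi: "g (\<phi> x) (\<phi> y) = g x y - \<eta> x * \<eta> y"
  using almost_contact unfolding almost_contact_metric_def by blast+

lemma bil_g: "bilinear g" and g_sym: "g x y = g y x" and g_nondeg: "(\<And>y. g x y = 0) \<Longrightarrow> x = 0"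
  using met by (auto simp: metric_form_def nondegenerate_on_def)

lemma bil_br: "bilinear br" and br_self: "br x x = 0"
  and jacobi: "br x (br y z) + br y (br z x) + br z (br x y) = 0"
  using lie by (auto simp: lie_algebra_def)

lemmas lin_simps =
  linear_add[OF lin_phi] linear_cmul[OF lin_phi] linear_neg[OF lin_phi] linear_diff[OF lin_phi] linear_0[OF lin_phi]
  linear_add[OF lin_eta] linear_cmul[OF lin_eta] linear_neg[OF lin_eta] linear_diff[OF lin_eta] linear_0[OF lin_eta]
  bilinear_ladd[OF bil_g] bilinear_radd[OF bil_g] bilinear_lmul[OF bil_g] bilinear_rmul[OF bil_g]
  bilinear_lneg[OF bil_g] bilinear_rneg[OF bil_g] bilinear_lzero[OF bil_g] bilinear_rzero[OF bil_g]
  bilinear_lsub[OF bil_g] bilinear_rsub[OF bil_g]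
  bilinear_ladd[OF bil_br] bilinear_radd[OF bil_br] bilinear_lmul[OF bil_br] bilinear_rmul[OF bil_br]
  bilinear_lneg[OF bil_br] bilinear_rneg[OF bil_br] bilinear_lzero[OF bil_br] bilinear_rzero[OF bil_br]
  bilinear_lsub[OF bil_br] bilinear_rsub[OF bil_br]

lemma br_anti: "br y x = - br x y"
proof -
  have "br x y + br y x = 0" using br_self[of "x + y"] unfolding lin_simps by (simp add: br_self add.commute)
  then show ?thesis by (metis add_eq_0_iff)
qed

lemma jacobi': "br x (br y z) = br (br x y) z + br y (br x z)"
proof -
  have "br x (br y z) = - (br y (br z x) + br z (br x y))"
    using jacobi[of x y z] by (metis add.assoc eq_neg_iff_add_eq_0)
  moreover have "br y (br x z) = - br y (br z x)" "br (br x y) z = - br z (br x y)"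
    using br_anti[of x z] br_anti[of "br x y" z] by (simp_all add: lin_simps)
  ultimately show ?thesis by simp
qed

lemma phi_xi: "\<phi> \<xi> = 0"
  using phi_phi[of "\<phi> \<xi>"] by (simp add: eta_phi phi_phi eta_xi lin_simps)

lemma phi_skew: "g x (\<phi> y) = - g (\<phi> x) y"
  using met_phi[of x "\<phi> y"] eta_met[of "\<phi> x"]
  by (simp add: eta_phi phi_phi lin_simps g_sym[of _ \<xi>])

lemma eta_br: "\<eta> (br x y) = - 2 * g x (\<phi> y)"
  using sasaki by (auto simp: sasaki_def ext_deriv_def fundamental_form_def; metis minus_equation_iff)

lemma nij: "br (\<phi> x) (\<phi> y) - \<phi> (br (\<phi> x) y) - \<phi> (br x (\<phi> y)) = br x y"
proof -
  have "nijenhuis br \<phi> x y + (- \<eta> (br x y)) *\<^sub>R \<xi> = 0"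
    using sasaki unfolding sasaki_def ext_deriv_def by blast
  then show ?thesis by (simp add: nijenhuis_def phi_phi algebra_simps)
qed

lemma subspace_I: "subspace I" and ideal_I: "y \<in> I \<Longrightarrow> br x y \<in> I"
  using ideal by (auto simp: lie_ideal_def)

lemma br_I: "x \<in> I \<Longrightarrow> br x y \<in> I"
  using br_anti[of x y] ideal_I[of x y] subspace_neg[OF subspace_I] by simp

lemma b_I: "b \<in> I" and b_central: "x \<in> I \<Longrightarrow> br b x = 0" "x \<in> I \<Longrightarrow> br x b = 0"
proof -
  show "b \<in> I" and *: "\<And>x. x \<in> I \<Longrightarrow> br b x = 0"
    using central unfolding lie_center_def b_def by blast+
  show "x \<in> I \<Longrightarrow> br x b = 0" using *[of x] br_anti[of x b] by simp
qed

lemma tau_simps: "\<tau> * \<tau> = 1" "\<tau> \<noteq> 0" using \<tau> by auto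

lemma g_e0: "x \<in> I \<Longrightarrow> g e0 x = 0" "g e0 e0 = \<tau>"
  using met_split[of 0 x 1 0] met_split[of 0 0 1 1] subspace_0[OF subspace_I]
  by (simp_all add: lin_simps)

lemma I_iff: "x \<in> I \<longleftrightarrow> g e0 x = 0"
proof
  assume 0: "g e0 x = 0"
  obtain y t where "y \<in> I" "x = y + t *\<^sub>R e0" using split by metis
  with 0 show "x \<in> I" by (simp add: lin_simps g_e0 tau_simps)
qed (rule g_e0)

lemma spanning_5:
  assumes "independent E" "card E = 5"
  shows "span E = (UNIV :: 'a set)"
proof (rule ccontr)
  obtain B :: "'a set" where B: "independent B" "span B = UNIV" "card B = 5"
    using basis_exists[of "UNIV :: 'a set"] dim5 by (metis UNIV_I subsetI subset_antisym)
  then have fB: "finite B" by (intro card_ge_0_finite) simp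
  assume "span E \<noteq> UNIV"
  then obtain x where "x \<notin> span E" by blast
  then have "independent (insert x E)" "x \<notin> E"
    using independent_insertI[OF _ assms(1)] span_base[of x E] by auto
  then have "card (insert x E) \<le> 5"
    using independent_span_bound[OF fB] B(2,3) by (metis subset_UNIV)
  moreover have "finite E" using assms(2) by (intro card_ge_0_finite) simp
  ultimately show False using assms(2) \<open>x \<notin> E\<close> by simp
qed

lemma not_spanning:
  assumes "finite E" "card E < 5"
  shows "span E \<noteq> (UNIV :: 'a set)"
proof
  assume "span E = UNIV"
  obtain B :: "'a set" where B: "independent B" "span B = UNIV" "card B = 5"
    using basis_exists[of "UNIV :: 'a set"] dim5 by (metis UNIV_I subsetI subset_antisym)
  then show False
    using independent_span_bound[OF assms(1), of B] \<open>span E = UNIV\<close> assms(2) by simp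
qed

lemma phi_b: "\<phi> b = e0 - \<eta> e0 *\<^sub>R \<xi>"
  by (simp add: b_def lin_simps phi_phi)

lemma phi_e0: "\<phi> e0 = - b" by (simp add: b_def)

text \<open>As \<open>b\<close> is central in \<open>I\<close>, the vector \<open>\<phi> b = e0 - \<eta>(e0) \<xi>\<close> is orthogonal to \<open>I\<close>, so
  \<open>\<eta>(e0) \<noteq> 0\<close> would make \<open>\<eta>\<close> vanish on \<open>I\<close>. Then \<open>d\<eta> = 2\<Phi>\<close> vanishes on \<open>I\<close>, so that \<open>\<phi>\<close> maps \<open>I\<close> to
  the line of \<open>e0\<close>, and applying \<open>\<phi>\<close> again puts \<open>I\<close> on the line of \<open>b\<close>, against the dimension.\<close>

lemma eta_e0: "\<eta> e0 = 0"
proof (rule ccontr)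
  assume ne: "\<eta> e0 \<noteq> 0"
  have eta_I: "\<eta> x = 0" if "x \<in> I" for x
  proof -
    have "0 = \<eta> (br x b)" using b_central(2)[OF that] by (simp add: lin_simps)
    also have "\<dots> = 2 * \<eta> e0 * \<eta> x"
      unfolding eta_br phi_b using that by (simp add: lin_simps g_e0 g_sym[of x] eta_met)
    finally show ?thesis using ne by simp
  qed
  have "x \<in> span {b}" if "x \<in> I" for x
  proof -
    obtain z t where z: "z \<in> I" "\<phi> x = z + t *\<^sub>R e0" using split by metis
    have "g z y = 0" if "y \<in> I" for y
    proof -
      have "\<eta> (br y x) = 0" using eta_I ideal_I[OF \<open>x \<in> I\<close>] by blast
      then have "g y (z + t *\<^sub>R e0) = 0" by (simp add: eta_br z(2))
      then show ?thesis using that g_e0 by (simp add: lin_simps g_sym[of y])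
    qed
    then have "z = 0" using nondeg_I z(1) unfolding nondegenerate_on_def by blast
    then have "- x = \<phi> (t *\<^sub>R e0)" using phi_phi[of x] eta_I[OF that] z(2) by simp
    then have "x = t *\<^sub>R b" by (simp add: lin_simps phi_e0)
    then show ?thesis by (metis span_base span_scale singletonI)
  qed
  then have "I \<subseteq> span {b, e0}" using span_mono[of "{b}" "{b, e0}"] by blast
  then have "x \<in> span {b, e0}" for x
    using split[of x] by (auto intro!: span_add span_scale intro: span_base)
  moreover have "card {b, e0} < 5" by (simp add: card_insert_if)
  ultimately show False using not_spanning[of "{b, e0}"] by blast
qed

lemma xi_I: "\<xi> \<in> I" using eta_e0 by (simp add: I_iff eta_met g_sym)

lemma phi_b': "\<phi> b = e0" using phi_b eta_e0 by simp

lemma eta_b: "\<eta> b = 0" by (simp add: b_def lin_simps eta_phi)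

lemma g_table:
  "g b b = \<tau>" "g b \<xi> = 0" "g \<xi> b = 0" "g \<xi> \<xi> = 1" "g e0 \<xi> = 0" "g \<xi> e0 = 0" "g e0 b = 0" "g b e0 = 0"
proof -
  show "g b b = \<tau>" by (simp add: b_def lin_simps met_phi eta_e0 g_e0)
  show "g b \<xi> = 0" "g \<xi> b = 0" "g \<xi> \<xi> = 1" "g e0 \<xi> = 0" "g \<xi> e0 = 0"
    using eta_b eta_e0 eta_xi g_sym unfolding eta_met by metis+
  show "g e0 b = 0" "g b e0 = 0" using g_e0(1)[OF b_I] g_sym by metis+
qed

definition W :: "'a set" where "W = {x. \<eta> x = 0 \<and> g b x = 0 \<and> g e0 x = 0}"

lemma W_I: "x \<in> W \<Longrightarrow> x \<in> I" by (simp add: W_def I_iff)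

lemma phi_W: "x \<in> W \<Longrightarrow> \<phi> x \<in> W"
  using phi_skew[of b x] phi_skew[of e0 x] by (simp add: W_def eta_phi phi_b' phi_e0 lin_simps)

lemma phi_phi_W: "x \<in> W \<Longrightarrow> \<phi> (\<phi> x) = - x" by (simp add: W_def phi_phi)

lemma W_orth:
  assumes "x \<in> W"
  shows "g \<xi> x = 0" "g x \<xi> = 0" "g b x = 0" "g x b = 0" "g e0 x = 0" "g x e0 = 0" "g x (\<phi> x) = 0" "g (\<phi> x) x = 0"
proof -
  show *: "g \<xi> x = 0" "g b x = 0" "g e0 x = 0" using assms by (simp_all add: W_def eta_met)
  show "g x \<xi> = 0" "g x b = 0" "g x e0 = 0" using * g_sym by metis+
  show "g x (\<phi> x) = 0" "g (\<phi> x) x = 0" using phi_skew[of x x] g_sym[of "\<phi> x" x] by simp_all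
qed

lemma W_projection: "\<exists>y\<in>W. \<exists>r s t. x = y + r *\<^sub>R b + s *\<^sub>R \<xi> + t *\<^sub>R e0"
proof -
  let ?y = "x - ((\<tau> * g b x) *\<^sub>R b + \<eta> x *\<^sub>R \<xi> + (\<tau> * g e0 x) *\<^sub>R e0)"
  have "\<eta> ?y = 0" "g b ?y = 0" "g e0 ?y = 0"
    using g_table tau_simps by (simp_all add: lin_simps eta_met g_e0(2))
  then have "?y \<in> W" by (simp add: W_def)
  moreover have "x = ?y + (\<tau> * g b x) *\<^sub>R b + \<eta> x *\<^sub>R \<xi> + (\<tau> * g e0 x) *\<^sub>R e0" by simp
  ultimately show ?thesis by blast
qed

text \<open>If all norms on \<open>W\<close> were zero, \<open>W\<close> would be orthogonal to itself by polarization and hence to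
  everything, so \<open>W\<close> would vanish and three vectors would span.\<close>

lemma exists_unit: "\<exists>w\<in>W. \<exists>\<epsilon>\<in>{1, -1}. g w w = \<epsilon>"
proof -
  have "\<exists>w\<in>W. g w w \<noteq> 0"
  proof (rule ccontr)
    assume "\<not> ?thesis"
    then have 0: "g w w = 0" if "w \<in> W" for w using that by blast
    have "x = 0" if x: "x \<in> W" for x
    proof (rule g_nondeg)
      fix y
      obtain z r s t where z: "z \<in> W" "y = z + r *\<^sub>R b + s *\<^sub>R \<xi> + t *\<^sub>R e0"
        using W_projection by metis
      have "x + z \<in> W" using x z(1) by (simp add: W_def lin_simps)
      then have "g x z = 0"
        using 0[of "x + z"] 0[OF x] 0[OF z(1)] g_sym[of z x] by (simp add: lin_simps)
      then show "g x y = 0"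
        using x by (simp add: z(2) lin_simps W_orth)
    qed
    have "x \<in> span {b, \<xi>, e0}" for x
    proof -
      obtain z r s t where "z \<in> W" "x = z + r *\<^sub>R b + s *\<^sub>R \<xi> + t *\<^sub>R e0"
        using W_projection by metis
      then have "x = r *\<^sub>R b + s *\<^sub>R \<xi> + t *\<^sub>R e0"
        using \<open>\<And>x. x \<in> W \<Longrightarrow> x = 0\<close> by simp
      then show ?thesis by (auto intro!: span_add span_scale intro: span_base)
    qed
    moreover have "card {b, \<xi>, e0} < 5" by (simp add: card_insert_if)
    ultimately show False using not_spanning[of "{b, \<xi>, e0}"] by blast
  qed
  then obtain w where w: "w \<in> W" "g w w \<noteq> 0" by blast
  let ?c = "1 / sqrt \<bar>g w w\<bar>"
  have "?c *\<^sub>R w \<in> W"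
    using w(1) by (simp add: W_def lin_simps)
  moreover have "g (?c *\<^sub>R w) (?c *\<^sub>R w) = g w w / \<bar>g w w\<bar>"
    by (simp add: lin_simps)
  moreover have "g w w / \<bar>g w w\<bar> \<in> {1, -1}" using w(2) by (auto simp: abs_if)
  ultimately show ?thesis by metis
qed

text \<open>Independence of an orthogonal frame of non-null vectors, built one vector at a time.\<close>

lemma orth_insert:
  assumes "independent E \<and> finite E \<and> card E = n" "\<forall>x\<in>E. g a x = 0" "g a a \<noteq> 0"
  shows "independent (insert a E) \<and> finite (insert a E) \<and> card (insert a E) = Suc n"
proof -
  have "g a x = 0" if "x \<in> span E" for x
    using that assms(2) by (induction rule: span_induct_alt) (simp_all add: lin_simps)
  then have "a \<notin> span E" using assms(3) by blast
  then have "independent (insert a E)" "a \<notin> E"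
    using independent_insertI assms(1) span_base by blast+
  then show ?thesis using assms(1) by simp
qed

context
  fixes w \<epsilon>
  assumes w: "w \<in> W" and \<epsilon>: "\<epsilon> \<in> {1, -1}" and gww: "g w w = \<epsilon>"
begin

lemma eps_simps: "\<epsilon> * \<epsilon> = 1" "\<epsilon> \<noteq> 0" using \<epsilon> by auto

lemmas phi_w = phi_W[OF w]
lemmas w_table = W_orth[OF w] W_orth(1-6)[OF phi_w] gww

lemma eta_w: "\<eta> w = 0" "\<eta> (\<phi> w) = 0" using w eta_phi by (simp_all add: W_def)

lemma g_phi_w: "g (\<phi> w) (\<phi> w) = \<epsilon>" by (simp add: met_phi gww eta_w)

lemma span_frame: "span {w, \<phi> w, b, \<xi>, e0} = UNIV"
proof -
  have "independent ({} :: 'a set) \<and> finite ({} :: 'a set) \<and> card ({} :: 'a set) = 0"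
    by (simp add: independent_empty)
  then have "independent {e0} \<and> finite {e0} \<and> card {e0} = Suc 0"
    by (rule orth_insert) (simp_all add: g_e0 tau_simps)
  then have "independent {\<xi>, e0} \<and> finite {\<xi>, e0} \<and> card {\<xi>, e0} = Suc (Suc 0)"
    by (rule orth_insert) (simp_all add: g_table)
  then have "independent {b, \<xi>, e0} \<and> finite {b, \<xi>, e0} \<and> card {b, \<xi>, e0} = Suc (Suc (Suc 0))"
    by (rule orth_insert) (simp_all add: g_table tau_simps)
  then have "independent {\<phi> w, b, \<xi>, e0} \<and> finite {\<phi> w, b, \<xi>, e0} \<and> card {\<phi> w, b, \<xi>, e0} = Suc (Suc (Suc (Suc 0)))"
    by (rule orth_insert) (simp_all add: w_table g_phi_w eps_simps)
  then have "independent {w, \<phi> w, b, \<xi>, e0} \<and> finite {w, \<phi> w, b, \<xi>, e0}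
      \<and> card {w, \<phi> w, b, \<xi>, e0} = Suc (Suc (Suc (Suc (Suc 0))))"
    by (rule orth_insert) (simp_all add: w_table eps_simps)
  then show ?thesis by (intro spanning_5) simp_all
qed

lemma expand:
  "x = (\<epsilon> * g w x) *\<^sub>R w + (\<epsilon> * g (\<phi> w) x) *\<^sub>R \<phi> w + (\<tau> * g b x) *\<^sub>R b + \<eta> x *\<^sub>R \<xi>
     + (\<tau> * g e0 x) *\<^sub>R e0" (is "x = ?y")
proof -
  have frame: "\<forall>z\<in>{w, \<phi> w, b, \<xi>, e0}. g z (x - ?y) = 0"
    using eps_simps tau_simps by (auto simp: lin_simps w_table g_phi_w g_table g_e0(2) eta_met)
  have "g z d = 0" if "\<forall>z\<in>E. g z d = 0" "z \<in> span E" for z d E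
    using that(2,1) by (induction rule: span_induct_alt) (simp_all add: lin_simps)
  from this[OF frame] have "g z (x - ?y) = 0" for z
    using span_frame by blast
  then have "x - ?y = 0"
    using g_nondeg[of "x - ?y"] g_sym by metis
  then show ?thesis by simp
qed

lemma expand_I:
  assumes "x \<in> I"
  shows "x = (\<epsilon> * g w x) *\<^sub>R w + (\<epsilon> * g (\<phi> w) x) *\<^sub>R \<phi> w + (\<tau> * g b x) *\<^sub>R b + \<eta> x *\<^sub>R \<xi>"
  using expand[of x] g_e0(1)[OF assms] by simp

lemma xi_phi: "br \<xi> (\<phi> y) = \<phi> (br \<xi> y)"
  using nij[of \<xi> "\<phi> y"] by (simp add: phi_xi phi_phi lin_simps br_self)

lemma eta_br_xi: "\<eta> (br \<xi> y) = 0"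
  using eta_met[of "\<phi> y"] by (simp add: eta_br eta_phi)

lemma xi_b: "br \<xi> b = 0" by (rule b_central(2)[OF xi_I])

lemma xi_e0: "br \<xi> e0 = 0" "br e0 \<xi> = 0"
proof -
  show "br \<xi> e0 = 0" using xi_phi[of b] by (simp add: phi_b' xi_b lin_simps)
  then show "br e0 \<xi> = 0" using br_anti[of \<xi> e0] by simp
qed

text \<open>The endomorphism \<open>ad \<xi>\<close> commutes with \<open>\<phi>\<close>, and it is skew because \<open>\<Phi>\<close> is closed and \<open>\<xi>\<close>
  annihilates it. So on the plane \<open>W\<close> it is a multiple \<open>n \<phi>\<close> of the complex structure, which is
  not nilpotent unless \<open>n = 0\<close>.\<close>

lemma xi_w: "br \<xi> w = 0"
proof -
  let ?u = "br \<xi> w"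
  have u: "?u \<in> I" using br_I xi_I by blast
  have "\<eta> (br e0 ?u) = 0"
    using jacobi'[of e0 \<xi> w] by (simp add: xi_e0 lin_simps eta_br_xi)
  then have b: "g b ?u = 0"
    unfolding eta_br phi_skew phi_e0 by (simp add: lin_simps)
  have "\<eta> (br (\<phi> w) ?u) = \<eta> (br (br (\<phi> w) \<xi>) w)"
    using jacobi'[of "\<phi> w" \<xi> w] by (simp add: lin_simps eta_br_xi)
  moreover have "br (\<phi> w) \<xi> = - \<phi> ?u" using br_anti[of \<xi> "\<phi> w"] by (simp add: xi_phi)
  ultimately have "- 2 * g (\<phi> w) (\<phi> ?u) = 2 * g (\<phi> ?u) (\<phi> w)"
    by (simp add: eta_br lin_simps)
  then have "g (\<phi> w) (\<phi> ?u) = 0" using g_sym[of "\<phi> ?u"] by simp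
  then have "g w ?u = 0" by (simp add: met_phi eta_w)
  with b eta_br_xi[of w] expand_I[OF u] have n: "?u = (\<epsilon> * g (\<phi> w) ?u) *\<^sub>R \<phi> w" (is "_ = ?n *\<^sub>R _")
    by simp
  have "br \<xi> (\<phi> w) = \<phi> (?n *\<^sub>R \<phi> w)" unfolding xi_phi using n by metis
  then have n': "br \<xi> (\<phi> w) = - (?n *\<^sub>R w)" by (simp add: lin_simps phi_phi_W[OF w])
  have "?n = 0"
  proof (rule ccontr)
    assume ne: "?n \<noteq> 0"
    have "w = (- 1 / ?n) *\<^sub>R br \<xi> (\<phi> w)" unfolding n' using ne by simp
    moreover have "\<phi> w = (1 / ?n) *\<^sub>R (?n *\<^sub>R \<phi> w)" using ne by simp
    then have "\<phi> w = (1 / ?n) *\<^sub>R br \<xi> w" using n by metis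
    ultimately have "{w, \<phi> w} \<subseteq> {0}"
      using nilpotent xi_I W_I[OF w] W_I[OF phi_w]
      by (intro nilpotent_no_eigenspace[of br I]) blast+
    then show False using gww eps_simps by (simp add: lin_simps)
  qed
  then show ?thesis using n by (metis scaleR_zero_left)
qed

lemma xi_phi_w: "br \<xi> (\<phi> w) = 0" by (simp add: xi_phi xi_w lin_simps)

lemma br_xi: "br \<xi> x = 0" "br x \<xi> = 0"
proof -
  show "br \<xi> x = 0"
    by (subst expand[of x]) (simp only: lin_simps xi_w xi_phi_w xi_b xi_e0 br_self, simp)
  then show "br x \<xi> = 0" using br_anti[of \<xi> x] by simp
qed

lemma b_w: "br w b = 0" "br (\<phi> w) b = 0" "br b w = 0" "br b (\<phi> w) = 0"
  using b_central W_I w phi_w by blast+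

lemma br_w_phi_w_ne: "br w (\<phi> w) \<noteq> 0" and eta_br_w_phi_w: "\<eta> (br w (\<phi> w)) = 2 * \<epsilon>"
proof -
  show *: "\<eta> (br w (\<phi> w)) = 2 * \<epsilon>" by (simp add: eta_br phi_phi_W[OF w] lin_simps gww)
  show "br w (\<phi> w) \<noteq> 0" using * eps_simps by (auto simp: lin_simps)
qed

lemma br_w_I:
  assumes "x \<in> I"
  shows "br w x = (\<epsilon> * g (\<phi> w) x) *\<^sub>R br w (\<phi> w)"
    and "br (\<phi> w) x = (- \<epsilon> * g w x) *\<^sub>R br w (\<phi> w)"
proof -
  show "br w x = (\<epsilon> * g (\<phi> w) x) *\<^sub>R br w (\<phi> w)"
    by (subst expand_I[OF assms]) (simp only: lin_simps b_w br_xi br_self, simp)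
  show "br (\<phi> w) x = (- \<epsilon> * g w x) *\<^sub>R br w (\<phi> w)"
    by (subst expand_I[OF assms]) (simp only: lin_simps b_w br_xi br_self br_anti[of w "\<phi> w"], simp)
qed

text \<open>A component of \<open>v = [w, \<phi> w]\<close> along \<open>w\<close> or \<open>\<phi> w\<close> would make \<open>v\<close> an eigenvector of \<open>ad (\<phi> w)\<close> or \<open>ad w\<close>
  with nonzero eigenvalue.\<close>

lemma br_w_phi_w: "br w (\<phi> w) = (\<tau> * g b (br w (\<phi> w))) *\<^sub>R b + (2 * \<epsilon>) *\<^sub>R \<xi>"
proof -
  let ?v = "br w (\<phi> w)"
  have v: "?v \<in> I" using br_I W_I[OF w] by blast
  have no: "n = 0" if "x \<in> I" "br x ?v = n *\<^sub>R ?v" for x n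
  proof (rule ccontr)
    assume "n \<noteq> 0"
    with that have "?v = (1 / n) *\<^sub>R br x ?v" by simp
    then have "{?v} \<subseteq> {0}"
      using nilpotent v that(1) by (intro nilpotent_no_eigenspace[of br I]) blast+
    then show False using br_w_phi_w_ne by blast
  qed
  have "\<epsilon> * g (\<phi> w) ?v = 0" "- \<epsilon> * g w ?v = 0"
    using no[OF W_I[OF w] br_w_I(1)[OF v]] no[OF W_I[OF phi_w] br_w_I(2)[OF v]] .
  then show ?thesis
    using expand_I[OF v] eps_simps by (simp add: eta_br_w_phi_w)
qed

lemma e0_phi_w: "br e0 (\<phi> w) = \<phi> (br e0 w)"
  using nij[of e0 "\<phi> w"] by (simp add: phi_e0 phi_phi_W[OF w] lin_simps b_w)

text \<open>The component along \<open>b\<close> vanishes because \<open>\<phi> [e0, w] = [e0, \<phi> w]\<close> lies in the ideal, hence has no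
  component along \<open>e0 = \<phi> b\<close>.\<close>

lemma e0_w: "br e0 w = (\<epsilon> * g w (br e0 w)) *\<^sub>R w + (\<epsilon> * g (\<phi> w) (br e0 w)) *\<^sub>R \<phi> w"
proof -
  let ?u = "br e0 w"
  have "\<phi> ?u \<in> I" using ideal_I[OF W_I[OF phi_w], of e0] by (simp add: e0_phi_w)
  then have "g e0 (\<phi> ?u) = 0" by (rule g_e0)
  then have "g b ?u = 0" by (simp add: phi_skew phi_e0 lin_simps)
  moreover have "\<eta> ?u = 0" by (simp add: eta_br w_table)
  ultimately show ?thesis using expand_I[OF ideal_I[OF W_I[OF w]], of e0] by simp
qed

text \<open>A derivation preserves the center of \<open>I\<close>, and an element of the center has no component in \<open>W\<close>
  because \<open>[w, \<phi> w] \<noteq> 0\<close>.\<close>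

lemma e0_b: "br e0 b = (\<tau> * g b (br e0 b)) *\<^sub>R b - (2 * \<tau>) *\<^sub>R \<xi>"
proof -
  let ?z = "br e0 b"
  have z: "?z \<in> I" by (rule ideal_I[OF b_I])
  have "br x ?z = 0" if "x \<in> I" for x
    using jacobi'[of x e0 b] b_central(2)[OF that] b_central(2)[OF br_I[OF that]] by (simp add: lin_simps)
  then have "g (\<phi> w) ?z = 0" "g w ?z = 0"
    using br_w_I[OF z] W_I[OF w] W_I[OF phi_w] br_w_phi_w_ne eps_simps by auto
  moreover have "\<eta> ?z = - 2 * \<tau>" by (simp add: eta_br phi_b' g_e0)
  ultimately show ?thesis using expand_I[OF z] by simp
qed

text \<open>On \<open>W\<close> the map \<open>ad e0\<close> is \<open>p + q \<phi>\<close>, of trace \<open>2p\<close>, so \<open>ad e0\<close> multiplies \<open>[w, \<phi> w]\<close> by \<open>2p\<close>. Comparing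
  the components along \<open>\<xi>\<close> and \<open>b\<close> gives the coefficient of \<open>b\<close> in \<open>[w, \<phi> w]\<close> and the relation
  \<open>p (l - 2p) = 0\<close>.\<close>

lemma frame_brackets:
  "\<exists>p q l. p * (l - 2 * p) = 0 \<and> br w (\<phi> w) = (- 2 * p * \<epsilon> * \<tau>) *\<^sub>R b + (2 * \<epsilon>) *\<^sub>R \<xi> \<and>
     br e0 w = p *\<^sub>R w + q *\<^sub>R \<phi> w \<and> br e0 (\<phi> w) = p *\<^sub>R \<phi> w - q *\<^sub>R w \<and>
     br e0 b = l *\<^sub>R b - (2 * \<tau>) *\<^sub>R \<xi>"
proof -
  obtain p q l \<alpha> where p: "br e0 w = p *\<^sub>R w + q *\<^sub>R \<phi> w" and l: "br e0 b = l *\<^sub>R b - (2 * \<tau>) *\<^sub>R \<xi>"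
    and \<alpha>: "br w (\<phi> w) = \<alpha> *\<^sub>R b + (2 * \<epsilon>) *\<^sub>R \<xi>"
    using e0_w e0_b br_w_phi_w by metis
  have q: "br e0 (\<phi> w) = p *\<^sub>R \<phi> w - q *\<^sub>R w"
    by (simp add: e0_phi_w p lin_simps phi_phi_W[OF w])
  have "br e0 (br w (\<phi> w)) = (2 * p) *\<^sub>R br w (\<phi> w)"
    using jacobi'[of e0 w "\<phi> w"] unfolding p q
    by (simp add: lin_simps br_self flip: scaleR_add_left)
  then have *: "\<alpha> *\<^sub>R (l *\<^sub>R b - (2 * \<tau>) *\<^sub>R \<xi>) = (2 * p) *\<^sub>R (\<alpha> *\<^sub>R b + (2 * \<epsilon>) *\<^sub>R \<xi>)"
    unfolding \<alpha> by (simp add: lin_simps l xi_e0)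
  have "- (\<alpha> * \<tau>) = 2 * (\<epsilon> * p)"
    using arg_cong[OF *, of \<eta>] by (simp add: lin_simps eta_b eta_xi)
  then have "\<alpha> * \<tau> = - 2 * p * \<epsilon>" by algebra
  then have \<alpha>': "\<alpha> = - 2 * p * \<epsilon> * \<tau>"
    using tau_simps by (metis mult.assoc mult.right_neutral)
  have "\<alpha> * l * \<tau> = 2 * p * \<alpha> * \<tau>"
    using arg_cong[OF *, of "g b"] by (auto simp: lin_simps g_table)
  then have "p * (l - 2 * p) = 0" using \<alpha>' tau_simps eps_simps by auto
  with p q l \<alpha> \<alpha>' show ?thesis by blast
qed

lemma br_frame:
  assumes wf: "br w (\<phi> w) = (- 2 * p * \<epsilon> * \<tau>) *\<^sub>R b + (2 * \<epsilon>) *\<^sub>R \<xi>"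
    and ew: "br e0 w = p *\<^sub>R w + q *\<^sub>R \<phi> w" and ef: "br e0 (\<phi> w) = p *\<^sub>R \<phi> w - q *\<^sub>R w"
    and eb: "br e0 b = l *\<^sub>R b - (2 * \<tau>) *\<^sub>R \<xi>"
  shows "br (x1 *\<^sub>R w + x2 *\<^sub>R \<phi> w + x3 *\<^sub>R b + x4 *\<^sub>R \<xi> + x5 *\<^sub>R e0)
            (y1 *\<^sub>R w + y2 *\<^sub>R \<phi> w + y3 *\<^sub>R b + y4 *\<^sub>R \<xi> + y5 *\<^sub>R e0)
       = (p * (x5 * y1 - x1 * y5) - q * (x5 * y2 - x2 * y5)) *\<^sub>R w
       + (q * (x5 * y1 - x1 * y5) + p * (x5 * y2 - x2 * y5)) *\<^sub>R \<phi> w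
       + (- 2 * p * \<epsilon> * \<tau> * (x1 * y2 - x2 * y1) + l * (x5 * y3 - x3 * y5)) *\<^sub>R b
       + (2 * \<epsilon> * (x1 * y2 - x2 * y1) - 2 * \<tau> * (x5 * y3 - x3 * y5)) *\<^sub>R \<xi>"
proof -
  have fw: "br (\<phi> w) w = - ((- 2 * p * \<epsilon> * \<tau>) *\<^sub>R b + (2 * \<epsilon>) *\<^sub>R \<xi>)"
    using br_anti[of w "\<phi> w"] wf by simp
  have we: "br w e0 = - (p *\<^sub>R w + q *\<^sub>R \<phi> w)" using br_anti[of e0 w] ew by simp
  have fe: "br (\<phi> w) e0 = - (p *\<^sub>R \<phi> w - q *\<^sub>R w)" using br_anti[of e0 "\<phi> w"] ef by simp
  have be: "br b e0 = - (l *\<^sub>R b - (2 * \<tau>) *\<^sub>R \<xi>)" using br_anti[of e0 b] eb by simp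
  show ?thesis
    unfolding lin_simps fw we fe be wf ew ef eb br_self br_xi b_w
    by (simp add: algebra_simps)
qed

end

end

section \<open>Rescaling to the models\<close>

context z_sasaki
begin

context
  fixes w \<epsilon>
  assumes w: "w \<in> W" and \<epsilon>: "\<epsilon> \<in> {1, -1}" and gww: "g w w = \<epsilon>"
begin

lemmas frame_facts = w_table[OF w \<epsilon> gww] g_phi_w[OF w \<epsilon> gww] g_table g_e0(2) eta_w[OF w \<epsilon> gww] eta_b eta_e0 eta_xi

text \<open>The coordinates \<open>\<psi>\<close> belong to the frame \<open>w/c, \<epsilon> \<phi> w/c, s b/c, \<xi>/c\<^sup>2, s e0/c\<close>. It is orthonormal, up to signs,
  for the metric of the \<open>\<D>\<close>-homothety with constant \<open>c\<^sup>2\<close>, which scales by \<open>c\<^sup>2\<close> on the contact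
  distribution and by \<open>c\<^sup>4\<close> along \<open>\<xi>\<close>. Dividing \<open>e0\<close> by \<open>s c\<close> divides \<open>p, q, l\<close> by the same number.\<close>

lemma scaled_frame_isometric:
  assumes pl: "p * (l - 2 * p) = 0"
    and wf: "br w (\<phi> w) = (- 2 * p * \<epsilon> * \<tau>) *\<^sub>R b + (2 * \<epsilon>) *\<^sub>R \<xi>"
    and ew: "br e0 w = p *\<^sub>R w + q *\<^sub>R \<phi> w" and ef: "br e0 (\<phi> w) = p *\<^sub>R \<phi> w - q *\<^sub>R w"
    and eb: "br e0 b = l *\<^sub>R b - (2 * \<tau>) *\<^sub>R \<xi>"
    and c: "c > 0" and s: "s \<in> {1, -1}"
  shows "sasaki_isometric br (D_homothety (c\<^sup>2) S) (solv_bracket \<tau> (s * p / c) 0 (s * l / c)) (model_structure \<epsilon> \<tau>)"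
proof -
  have eps: "\<epsilon> * \<epsilon> = 1" and tau: "\<tau> * \<tau> = 1" and ss: "s * s = 1" using \<epsilon> \<tau> s by auto
  define X where "X x = vec5 (\<epsilon> * g w x) (\<epsilon> * g (\<phi> w) x) (\<tau> * g b x) (\<eta> x) (\<tau> * g e0 x)" for x
  define \<psi> where "\<psi> x = vec5 (c * X x $ 1) (c * \<epsilon> * X x $ 2) (c * s * X x $ 3) (c\<^sup>2 * X x $ 4) (c * s * X x $ 5)" for x
  define F where "F v = (v $ 1) *\<^sub>R w + (v $ 2) *\<^sub>R \<phi> w + (v $ 3) *\<^sub>R b + (v $ 4) *\<^sub>R \<xi> + (v $ 5) *\<^sub>R e0" for v :: "real ^ 5"
  have FX: "F (X x) = x" for x
    using expand[OF w \<epsilon> gww, of x] by (simp add: F_def X_def)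
  have XF: "X (F v) = v" for v
    using eps tau by (intro vec5_eqI) (simp_all add: F_def X_def lin_simps frame_facts)
  have "linear \<psi>"
    by (intro linearI vec5_eqI) (simp_all add: \<psi>_def X_def lin_simps algebra_simps)
  moreover have "bij \<psi>"
  proof (rule o_bij)
    let ?i = "\<lambda>v. F (vec5 (v $ 1 / c) (\<epsilon> * v $ 2 / c) (s * v $ 3 / c) (v $ 4 / c\<^sup>2) (s * v $ 5 / c))"
    have "vec5 (\<psi> x $ 1 / c) (\<epsilon> * \<psi> x $ 2 / c) (s * \<psi> x $ 3 / c) (\<psi> x $ 4 / c\<^sup>2) (s * \<psi> x $ 5 / c) = X x" for x
      using c eps ss by (intro vec5_eqI) (simp_all add: \<psi>_def mult.assoc[symmetric])
    then show "?i \<circ> \<psi> = id" by (simp add: fun_eq_iff FX)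
    have "\<psi> (?i v) = v" for v
      unfolding \<psi>_def XF using c eps ss by (intro vec5_eqI) (simp_all add: mult.assoc[symmetric])
    then show "\<psi> \<circ> ?i = id" by (simp add: fun_eq_iff)
  qed
  moreover have "\<psi> (br x y) = solv_bracket \<tau> (s * p / c) (s * \<epsilon> * q / c) (s * l / c) (\<psi> x) (\<psi> y)" for x y
  proof -
    let ?x = "X x" and ?y = "X y"
    have "br x y = br (F ?x) (F ?y)" by (simp only: FX)
    also have "\<dots> = F (vec5 (p * e2 5 1 ?x ?y - q * e2 5 2 ?x ?y) (q * e2 5 1 ?x ?y + p * e2 5 2 ?x ?y)
        (- 2 * p * \<epsilon> * \<tau> * e2 1 2 ?x ?y + l * e2 5 3 ?x ?y) (2 * \<epsilon> * e2 1 2 ?x ?y - 2 * \<tau> * e2 5 3 ?x ?y) 0)"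
      unfolding F_def br_frame[OF w \<epsilon> gww wf ew ef eb] by (simp add: e2_def mult.commute)
    finally have "X (br x y) = vec5 (p * e2 5 1 ?x ?y - q * e2 5 2 ?x ?y) (q * e2 5 1 ?x ?y + p * e2 5 2 ?x ?y)
        (- 2 * p * \<epsilon> * \<tau> * e2 1 2 ?x ?y + l * e2 5 3 ?x ?y) (2 * \<epsilon> * e2 1 2 ?x ?y - 2 * \<tau> * e2 5 3 ?x ?y) 0"
      by (simp only: XF)
    then show ?thesis
      using c \<epsilon> s \<tau>
      by (intro vec5_eqI)
        (auto simp: \<psi>_def solv_bracket_nth e2_def field_simps power2_eq_square)
  qed
  moreover have "cm_met (D_homothety (c\<^sup>2) S) x y = model_metric \<epsilon> \<tau> (\<psi> x) (\<psi> y)" for x y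
  proof -
    have "g x y = g (F (X x)) (F (X y))" by (simp only: FX)
    also have "\<dots> = \<epsilon> * (X x $ 1 * X y $ 1 + X x $ 2 * X y $ 2) + \<tau> * (X x $ 3 * X y $ 3)
        + X x $ 4 * X y $ 4 + \<tau> * (X x $ 5 * X y $ 5)"
      by (simp add: F_def lin_simps frame_facts algebra_simps)
    finally have "g x y = \<epsilon> * (X x $ 1 * X y $ 1 + X x $ 2 * X y $ 2) + \<tau> * (X x $ 3 * X y $ 3)
        + X x $ 4 * X y $ 4 + \<tau> * (X x $ 5 * X y $ 5)" .
    moreover have "\<eta> x = X x $ 4" "\<eta> y = X y $ 4" by (simp_all add: X_def)
    ultimately show ?thesis
      using \<epsilon> s by (auto simp: D_homothety_def model_metric_def \<psi>_def algebra_simps power2_eq_square)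
  qed
  moreover have "\<psi> (cm_xi (D_homothety (c\<^sup>2) S)) = axis 4 1"
    using c by (intro vec5_eqI) (simp_all add: D_homothety_def \<psi>_def X_def lin_simps frame_facts)
  moreover have "cm_eta (D_homothety (c\<^sup>2) S) x = \<psi> x $ 4" for x
    by (simp add: D_homothety_def \<psi>_def X_def)
  moreover have "\<psi> (cm_phi (D_homothety (c\<^sup>2) S) x) = cm_phi (model_structure \<epsilon> \<tau>) (\<psi> x)" for x
  proof -
    have "g w (\<phi> x) = - g (\<phi> w) x" "g (\<phi> w) (\<phi> x) = g w x" "g b (\<phi> x) = - g e0 x" "g e0 (\<phi> x) = g b x"
      using phi_skew[of w x] met_phi[of w x] phi_skew[of b x] phi_skew[of e0 x]
      by (simp_all add: frame_facts phi_b' phi_e0 lin_simps)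
    then show ?thesis
      using \<epsilon> by (intro vec5_eqI) (auto simp: D_homothety_def \<psi>_def X_def eta_phi)
  qed
  moreover have "\<tau>\<^sup>2 = 1" using tau by (simp add: power2_eq_square)
  moreover have "s * p / c * (s * l / c - 2 * (s * p / c)) = 0"
    using pl by (auto simp: algebra_simps)
  ultimately show ?thesis
    by (intro sasaki_isometric_solv[where r = "s * \<epsilon> * q / c" and \<psi> = \<psi>])
qed

end

lemma isometric_to_model:
  "\<exists>c > 0. \<exists>\<epsilon> \<in> {1, -1}. \<exists>(p, l) \<in> {(0, 0), (0, 2), (1, 2)}.
     sasaki_isometric br (D_homothety (c\<^sup>2) S) (solv_bracket \<tau> p 0 l) (model_structure \<epsilon> \<tau>)"
proof -
  obtain w \<epsilon> where w: "w \<in> W" "\<epsilon> \<in> {1, -1}" "g w w = \<epsilon>"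
    using exists_unit by blast
  obtain p q l where pl: "p * (l - 2 * p) = 0"
    and br: "br w (\<phi> w) = (- 2 * p * \<epsilon> * \<tau>) *\<^sub>R b + (2 * \<epsilon>) *\<^sub>R \<xi>"
      "br e0 w = p *\<^sub>R w + q *\<^sub>R \<phi> w" "br e0 (\<phi> w) = p *\<^sub>R \<phi> w - q *\<^sub>R w"
      "br e0 b = l *\<^sub>R b - (2 * \<tau>) *\<^sub>R \<xi>"
    using frame_brackets[OF w] by blast
  note iso = scaled_frame_isometric[OF w pl br]
  \<comment> \<open>Since \<open>l = 0\<close> implies \<open>p = 0\<close>, it is \<open>l\<close> that is normalized, to \<open>2\<close>.\<close>
  define c where "c = (if l = 0 then 1 else \<bar>l\<bar> / 2)"
  define s :: real where "s = (if l < 0 then -1 else 1)"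
  have c: "c > 0" and s: "s \<in> {1, -1}" by (auto simp: c_def s_def)
  have "(s * p / c, s * l / c) \<in> {(0, 0), (0, 2), (1, 2)}"
    using pl by (auto simp: c_def s_def divide_simps)
  with iso[OF c s] c w(2) show ?thesis by blast
qed

end

theorem theorem5p7:
  fixes br :: "'a::real_vector \<Rightarrow> 'a \<Rightarrow> 'a" and S :: "'a contact_metric"
  assumes "lie_algebra br"
    and "dim (UNIV :: 'a set) = 5"
    and "sasaki br S"
    and "z_standard br S"
  shows "\<exists>a > 0. \<exists>\<tau> \<in> {1, -1}. \<exists>\<epsilon> \<in> {1, -1}. \<exists>br' \<in> {model1 \<tau>, model2 \<tau>, model3 \<tau>}. \<exists>S'.
           lie_algebra br' \<and> sasaki br' S' \<and>
           cm_met S' = model_metric \<epsilon> \<tau> \<and>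
           cm_xi S' = axis 4 1 \<and>
           (\<forall>x y. fundamental_form S' x y = - e2 1 2 x y - \<tau> * e2 3 5 x y) \<and>
           sasaki_isometric br (D_homothety a S) br' S'"
proof -
  obtain I e0 \<tau> where "z_sasaki br S I e0 \<tau>"
    using assms unfolding z_standard_def z_sasaki_def by blast
  then interpret z_sasaki br S I e0 \<tau> .
  obtain c \<epsilon> p l where c: "c > 0" and \<epsilon>: "\<epsilon> \<in> {1, -1}" and pl: "(p, l) \<in> {(0, 0), (0, 2), (1, 2)}"
    and iso: "sasaki_isometric br (D_homothety (c\<^sup>2) S) (solv_bracket \<tau> p 0 l) (model_structure \<epsilon> \<tau>)"
    using isometric_to_model by blast
  have "\<tau>\<^sup>2 = 1" "p * (l - 2 * p) = 0" using \<tau> pl by auto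
  then have "lie_algebra (solv_bracket \<tau> p 0 l)" by (intro lie_algebra_solv)
  moreover have "solv_bracket \<tau> p 0 l \<in> {model1 \<tau>, model2 \<tau>, model3 \<tau>}"
    using pl by (auto simp: models)
  moreover have "c\<^sup>2 > 0" using c by simp
  ultimately show ?thesis
    using \<tau> \<epsilon> iso sasaki_model[OF \<epsilon> \<tau>, of p 0 l] model_fundamental_form[OF \<epsilon>, of \<tau>]
    by (intro exI[of _ "c\<^sup>2"] conjI bexI[of _ \<tau>] bexI[of _ \<epsilon>] bexI[of _ "solv_bracket \<tau> p 0 l"]
        exI[of _ "model_structure \<epsilon> \<tau>"]) simp_all
qed

end
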